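(* Let $A$ be a principal ideal domain with involution, let $\mathfrak p=(p)=\overline{\mathfrak p}$ be a prime ideal generated by a prime $p$, and suppose that $A/\mathfrak p$ contains a half-unit. Let $(T,\lambda)$ and $(T',\lambda')$ be non-singular $\varepsilon$-symmetric linking forms over $(A,\mathfrak p^\infty)$. Then there is an isomorphism of linking forms $(T,\lambda)\cong(T',\lambda')$ if and only if there is an isomorphism of $A$-modules $T\cong T'$ which induces, for each $l>0$, an isomorphism $(\Delta_l(T),b_l(\lambda))\cong(\Delta_l(T'),b_l(\lambda'))$ of $(u_p^l\varepsilon)$-symmetric forms over $A/\mathfrak p$.
   Context: $A$ is a commutative ring with unit and involution $a\mapsto\bar a$; $\varepsilon\in A$ is a unit with $\varepsilon\bar\varepsilon=1$. A half-unit in a ring with involution is a unit $s$ with $s+\bar s=1$. $\mathfrak p^\infty=\{vp^k: v\text{ a unit},\,k\ge0\}$. Since $\overline{\mathfrak p}=\mathfrak p$, one has $p=u_p\bar p$ for a unit $u_p\in A$ with $\overline{u_p}=u_p^{-1}$. For $S=\mathfrak p^\infty$: an $\varepsilon$-symmetric linking form $(T,\lambda)$ over $(A,S)$ is a f.g. $S$-torsion $A$-module $T$ (with a length one resolution by f.g. projectives, automatic here) and an injective homomorphism $\lambda:T\to T^\wedge=\mathrm{Hom}_A(T,S^{-1}A/A)$ (with $(af)(x)=f(x)\bar a$) satisfying $\lambda(x)(y)=\varepsilon\overline{\lambda(y)(x)}$; it is non-singular if $\lambda$ is an isomorphism; write $\lambda(x,y)=\lambda(x)(y)$. An isomorphism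 of linking forms is a module isomorphism preserving the pairings. An $\eta$-symmetric form over the field $A/\mathfrak p$ is a f.g. vector space with a pairing $b$, conjugate-linear in the first and linear in the second variable, satisfying $b(x,y)=\eta\overline{b(y,x)}$ and with injective adjoint. For $m\ge0$ let $K_m(T)=\ker(p^m:T\to T)$. The $l$th auxiliary module is the $A/\mathfrak p$-vector space $\Delta_l(T)=K_l(T)/(K_{l-1}(T)+pK_{l+1}(T))$, and the $l$th auxiliary form is $b_l(\lambda)([x],[y])=p^{l-1}\lambda(x,y)\in A/\mathfrak p$ for $x,y\in K_l(T)$, where $A/\mathfrak p\subset S^{-1}A/A$ via $a\mapsto a/p$. This is a $(u_p^l\varepsilon)$-symmetric form. A module isomorphism $T\cong T'$ induces isomorphisms $\Delta_l(T)\cong\Delta_l(T')$. *)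

theory Defs
  imports
    "HOL-Algebra.Algebra"
    "HOL-Algebra.Algebraic_Closure_Type"
    "HOL-Computational_Algebra.Fraction_Field"
begin

section \<open>Rings with involution\<close>

class involution_ring = comm_ring_1 +
  fixes bar :: "'a \<Rightarrow> 'a"
  assumes bar_add: "bar (a + b) = bar a + bar b"
    and bar_mult: "bar (a * b) = bar a * bar b"
    and bar_one: "bar 1 = 1"
    and bar_bar [simp]: "bar (bar a) = a"
begin

lemma bar_zero [simp]: "bar 0 = 0"
  using bar_add [of 0 0] by simp

lemma bar_minus: "bar (- a) = - bar a"
  using bar_add [of a "- a"] by (simp add: eq_neg_iff_add_eq_0 add.commute)

lemma bar_diff: "bar (a - b) = bar a - bar b"
  using bar_add [of a "- b"] by (simp add: bar_minus)

lemma bar_eq_0_iff [simp]: "bar a = 0 \<longleftrightarrow> a = 0"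
  by (metis bar_bar bar_zero)

end

definition half_unit :: "('k, 'm) ring_scheme \<Rightarrow> ('k \<Rightarrow> 'k) \<Rightarrow> 'k \<Rightarrow> bool"
  where "half_unit F c s \<longleftrightarrow> s \<in> Units F \<and> s \<oplus>\<^bsub>F\<^esub> c s = \<one>\<^bsub>F\<^esub>"


section \<open>The module \<open>S\<^sup>-\<^sup>1A/A\<close>\<close>

text \<open>
  For an integral domain \<open>A\<close> with fraction field \<open>K\<close> and a multiplicative set \<open>S\<close> not
  containing \<open>0\<close>, the ring \<open>S\<^sup>-\<^sup>1A\<close> is the subring of the fractions with denominator in \<open>S\<close>,
  and \<open>S\<^sup>-\<^sup>1A/A\<close> is a submodule of \<open>K/A\<close>. Only \<open>K/A\<close>, which does not depend on \<open>S\<close>, is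
  introduced as a type.
\<close>

lemma equivp_fract_mod:
  "equivp (\<lambda>x y :: 'a::idom fract. x - y \<in> range (\<lambda>a. Fract a 1))"
proof (intro equivpI reflpI sympI transpI)
  fix x y z :: "'a fract"
  show "x - x \<in> range (\<lambda>a. Fract a 1)"
    by (auto simp: Zero_fract_def)
  show "y - x \<in> range (\<lambda>a. Fract a 1)" if "x - y \<in> range (\<lambda>a. Fract a 1)"
  proof -
    from that obtain a where "x - y = Fract a 1" by auto
    then have "y - x = Fract (- a) 1" by (metis minus_diff_eq minus_fract)
    then show ?thesis by auto
  qed
  show "x - z \<in> range (\<lambda>a. Fract a 1)"
    if "x - y \<in> range (\<lambda>a. Fract a 1)" "y - z \<in> range (\<lambda>a. Fract a 1)"
  proof -
    from that obtain a b where "x - y = Fract a 1" "y - z = Fract b 1" by auto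
    moreover have "x - z = (x - y) + (y - z)" by simp
    ultimately have "x - z = Fract (a + b) 1" by simp
    then show ?thesis by auto
  qed
qed

quotient_type (overloaded) 'a fract_mod =
  "'a::idom fract" / "\<lambda>x y. x - y \<in> range (\<lambda>a. Fract a 1)"
  by (rule equivp_fract_mod)

instantiation fract_mod :: (idom) ab_group_add
begin

lift_definition zero_fract_mod :: "'a fract_mod" is 0 .

lift_definition plus_fract_mod :: "'a fract_mod \<Rightarrow> 'a fract_mod \<Rightarrow> 'a fract_mod" is "(+)"
proof -
  fix x x' y y' :: "'a fract"
  assume "x - x' \<in> range (\<lambda>a. Fract a 1)" "y - y' \<in> range (\<lambda>a. Fract a 1)"
  then obtain a b where "x - x' = Fract a 1" "y - y' = Fract b 1" by auto
  moreover have "x + y - (x' + y') = (x - x') + (y - y')" by simp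
  ultimately have "x + y - (x' + y') = Fract (a + b) 1" by simp
  then show "x + y - (x' + y') \<in> range (\<lambda>a. Fract a 1)" by auto
qed

lift_definition uminus_fract_mod :: "'a fract_mod \<Rightarrow> 'a fract_mod" is uminus
proof -
  fix x x' :: "'a fract"
  assume "x - x' \<in> range (\<lambda>a. Fract a 1)"
  then obtain a where "x - x' = Fract a 1" by auto
  moreover have "- x - - x' = - (x - x')" by simp
  ultimately have "- x - - x' = Fract (- a) 1" by simp
  then show "- x - - x' \<in> range (\<lambda>a. Fract a 1)" by auto
qed

definition minus_fract_mod :: "'a fract_mod \<Rightarrow> 'a fract_mod \<Rightarrow> 'a fract_mod"
  where "minus_fract_mod x y = x + (- y)"

instance
proof
  have *: "0 \<in> range (\<lambda>a::'a. Fract a 1)" by (auto simp: Zero_fract_def)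
  fix a b c :: "'a fract_mod"
  show "a + b + c = a + (b + c)" by transfer (simp add: add.assoc *)
  show "a + b = b + a" by transfer (simp add: add.commute *)
  show "0 + a = a" by transfer (simp add: *)
  show "- a + a = 0" by transfer (simp add: *)
  show "a - b = a + - b" by (simp add: minus_fract_mod_def)
qed

end

lift_definition fract_mod_scale :: "'a::idom \<Rightarrow> 'a fract_mod \<Rightarrow> 'a fract_mod"
  is "\<lambda>a x. Fract a 1 * x"
proof -
  fix a and x y :: "'a fract"
  assume "x - y \<in> range (\<lambda>a. Fract a 1)"
  then obtain b where "x - y = Fract b 1" by auto
  then have "Fract a 1 * x - Fract a 1 * y = Fract (a * b) 1"
    by (simp flip: right_diff_distrib)
  then show "Fract a 1 * x - Fract a 1 * y \<in> range (\<lambda>a. Fract a 1)" by auto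
qed

definition bar_fract :: "'a::{idom, involution_ring} fract \<Rightarrow> 'a fract"
  where "bar_fract q = (THE r. \<exists>a b. b \<noteq> 0 \<and> q = Fract a b \<and> r = Fract (bar a) (bar b))"

lemma bar_fract_Fract [simp]: "bar_fract (Fract a b) = Fract (bar a) (bar b)"
proof (cases "b = 0")
  case False
  show ?thesis
    unfolding bar_fract_def
  proof (rule the_equality)
    show "\<exists>a' b'. b' \<noteq> 0 \<and> Fract a b = Fract a' b' \<and> Fract (bar a) (bar b) = Fract (bar a') (bar b')"
      using False by blast
    show "r = Fract (bar a) (bar b)"
      if "\<exists>a' b'. b' \<noteq> 0 \<and> Fract a b = Fract a' b' \<and> r = Fract (bar a') (bar b')" for r
      using that False by (auto simp: eq_fract simp flip: bar_mult)
  qed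
next
  case True
  have "bar_fract (Fract 0 1) = (Fract 0 1 :: 'a fract)"
    unfolding bar_fract_def
  proof (rule the_equality)
    show "\<exists>a b. b \<noteq> 0 \<and> Fract 0 1 = Fract a b \<and> Fract 0 1 = (Fract (bar a) (bar b) :: 'a fract)"
      by (rule exI [of _ 0], rule exI [of _ 1]) (simp add: bar_one)
    show "r = Fract 0 1"
      if "\<exists>a b. b \<noteq> 0 \<and> Fract 0 1 = Fract a b \<and> r = Fract (bar a) (bar b)" for r :: "'a fract"
      using that by (auto simp: eq_fract)
  qed
  with True show ?thesis by (simp add: fract_collapse)
qed

lemma bar_fract_diff: "bar_fract (x - y) = bar_fract x - bar_fract y"
  by (cases x; cases y) (simp add: bar_diff bar_mult)

lift_definition bar_fract_mod ::
    "'a::{idom, involution_ring} fract_mod \<Rightarrow> 'a fract_mod"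
  is bar_fract
proof -
  fix x y :: "'a fract"
  assume "x - y \<in> range (\<lambda>a. Fract a 1)"
  then obtain a where "x - y = Fract a 1" by auto
  then have "bar_fract x - bar_fract y = Fract (bar a) 1"
    by (simp flip: bar_fract_diff add: bar_one)
  then show "bar_fract x - bar_fract y \<in> range (\<lambda>a. Fract a 1)" by auto
qed

lift_definition fract_class :: "'a::idom \<Rightarrow> 'a \<Rightarrow> 'a fract_mod" is Fract .

definition prime_powers :: "'a::comm_ring_1 \<Rightarrow> 'a set"
  where "prime_powers p = {v * p ^ k | v k. v dvd 1}"

definition loc_quot :: "'a::idom set \<Rightarrow> 'a fract_mod set"
  where "loc_quot S = {fract_class a s | a s. s \<in> S}"


section \<open>Linking forms\<close>

definition torsion_dual ::
    "'a::idom set \<Rightarrow> ('a \<Rightarrow> 't::ab_group_add \<Rightarrow> 't) \<Rightarrow> ('t \<Rightarrow> 'a fract_mod) set"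
  where "torsion_dual S scale =
    {f. module_hom scale fract_mod_scale f \<and> range f \<subseteq> loc_quot S}"

text \<open>
  \<open>lam x y\<close> is \<open>\<lambda>(x)(y)\<close>, linear in \<open>y\<close>; since \<open>a\<close> acts on the dual by \<open>(a f)(y) = f(y) bar a\<close>,
  linearity of \<open>\<lambda>\<close> is conjugate-linearity in \<open>x\<close>. Over a principal ideal domain every finitely
  generated module has a length one resolution by finitely generated projective modules, so this
  is not required separately.
\<close>

definition linking_form ::
    "'a::{idom, involution_ring} set \<Rightarrow> 'a \<Rightarrow> ('a \<Rightarrow> 't::ab_group_add \<Rightarrow> 't) \<Rightarrow>
      ('t \<Rightarrow> 't \<Rightarrow> 'a fract_mod) \<Rightarrow> bool"
  where "linking_form S \<epsilon> scale lam \<longleftrightarrow>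
    Modules.module scale \<and>
    (\<exists>B. finite B \<and> module.span scale B = UNIV) \<and>
    (\<forall>x. \<exists>s\<in>S. scale s x = 0) \<and>
    (\<forall>x. lam x \<in> torsion_dual S scale) \<and>
    (\<forall>x x' y. lam (x + x') y = lam x y + lam x' y) \<and>
    (\<forall>a x y. lam (scale a x) y = fract_mod_scale (bar a) (lam x y)) \<and>
    inj lam \<and>
    (\<forall>x y. lam x y = fract_mod_scale \<epsilon> (bar_fract_mod (lam y x)))"

definition nonsingular_linking_form ::
    "'a::{idom, involution_ring} set \<Rightarrow> 'a \<Rightarrow> ('a \<Rightarrow> 't::ab_group_add \<Rightarrow> 't) \<Rightarrow>
      ('t \<Rightarrow> 't \<Rightarrow> 'a fract_mod) \<Rightarrow> bool"
  where "nonsingular_linking_form S \<epsilon> scale lam \<longleftrightarrow>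
    linking_form S \<epsilon> scale lam \<and> bij_betw lam UNIV (torsion_dual S scale)"

definition module_iso ::
    "('a::comm_ring_1 \<Rightarrow> 't::ab_group_add \<Rightarrow> 't) \<Rightarrow> ('a \<Rightarrow> 't'::ab_group_add \<Rightarrow> 't') \<Rightarrow>
      ('t \<Rightarrow> 't') \<Rightarrow> bool"
  where "module_iso scale scale' h \<longleftrightarrow> module_hom scale scale' h \<and> bij h"

definition linking_form_iso ::
    "('a::idom \<Rightarrow> 't::ab_group_add \<Rightarrow> 't) \<Rightarrow> ('t \<Rightarrow> 't \<Rightarrow> 'a fract_mod) \<Rightarrow>
      ('a \<Rightarrow> 't'::ab_group_add \<Rightarrow> 't') \<Rightarrow> ('t' \<Rightarrow> 't' \<Rightarrow> 'a fract_mod) \<Rightarrow>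
      ('t \<Rightarrow> 't') \<Rightarrow> bool"
  where "linking_form_iso scale lam scale' lam' h \<longleftrightarrow>
    module_iso scale scale' h \<and> (\<forall>x y. lam' (h x) (h y) = lam x y)"


section \<open>Symmetric forms over a field with involution\<close>

definition symmetric_form ::
    "('k, 'm) ring_scheme \<Rightarrow> ('k \<Rightarrow> 'k) \<Rightarrow> 'k \<Rightarrow> ('k, 'v, 'n) module_scheme \<Rightarrow>
      ('v \<Rightarrow> 'v \<Rightarrow> 'k) \<Rightarrow> bool"
  where "symmetric_form F c \<eta> V b \<longleftrightarrow>
    field F \<and> Module.module F V \<and>
    (\<exists>B. finite B \<and> B \<subseteq> carrier V \<and> (\<forall>N. submodule N F V \<and> B \<subseteq> N \<longrightarrow> N = carrier V)) \<and>
    (\<forall>x\<in>carrier V. \<forall>y\<in>carrier V. b x y \<in> carrier F) \<and>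
    (\<forall>x\<in>carrier V. \<forall>x'\<in>carrier V. \<forall>y\<in>carrier V.
      b (x \<oplus>\<^bsub>V\<^esub> x') y = b x y \<oplus>\<^bsub>F\<^esub> b x' y) \<and>
    (\<forall>x\<in>carrier V. \<forall>y\<in>carrier V. \<forall>y'\<in>carrier V.
      b x (y \<oplus>\<^bsub>V\<^esub> y') = b x y \<oplus>\<^bsub>F\<^esub> b x y') \<and>
    (\<forall>a\<in>carrier F. \<forall>x\<in>carrier V. \<forall>y\<in>carrier V.
      b (a \<odot>\<^bsub>V\<^esub> x) y = c a \<otimes>\<^bsub>F\<^esub> b x y \<and> b x (a \<odot>\<^bsub>V\<^esub> y) = a \<otimes>\<^bsub>F\<^esub> b x y) \<and>
    (\<forall>x\<in>carrier V. \<forall>y\<in>carrier V. b x y = \<eta> \<otimes>\<^bsub>F\<^esub> c (b y x)) \<and>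
    inj_on (\<lambda>x. \<lambda>y\<in>carrier V. b x y) (carrier V)"

definition symmetric_form_iso ::
    "('k, 'm) ring_scheme \<Rightarrow> ('k \<Rightarrow> 'k) \<Rightarrow> 'k \<Rightarrow>
      ('k, 'v, 'n) module_scheme \<Rightarrow> ('v \<Rightarrow> 'v \<Rightarrow> 'k) \<Rightarrow>
      ('k, 'w, 'n') module_scheme \<Rightarrow> ('w \<Rightarrow> 'w \<Rightarrow> 'k) \<Rightarrow> ('v \<Rightarrow> 'w) \<Rightarrow> bool"
  where "symmetric_form_iso F c \<eta> V b W b' g \<longleftrightarrow>
    symmetric_form F c \<eta> V b \<and> symmetric_form F c \<eta> W b' \<and>
    bij_betw g (carrier V) (carrier W) \<and>
    (\<forall>x\<in>carrier V. \<forall>y\<in>carrier V. g (x \<oplus>\<^bsub>V\<^esub> y) = g x \<oplus>\<^bsub>W\<^esub> g y) \<and>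
    (\<forall>a\<in>carrier F. \<forall>x\<in>carrier V. g (a \<odot>\<^bsub>V\<^esub> x) = a \<odot>\<^bsub>W\<^esub> g x) \<and>
    (\<forall>x\<in>carrier V. \<forall>y\<in>carrier V. b' (g x) (g y) = b x y)"


section \<open>Auxiliary modules and forms\<close>

text \<open>
  The quotients \<open>A/(p)\<close> and \<open>\<Delta>\<^sub>l(T)\<close> depend on the terms \<open>p\<close> and \<open>l\<close>, so they are sets of
  cosets rather than types.
\<close>

definition principal_ideal :: "'a::comm_ring_1 \<Rightarrow> 'a set"
  where "principal_ideal p = PIdl\<^bsub>ring_of_type_algebra\<^esub> p"

definition residue_field :: "'a::comm_ring_1 \<Rightarrow> 'a set ring"
  where "residue_field p = ring_of_type_algebra Quot principal_ideal p"

definition residue :: "'a::comm_ring_1 \<Rightarrow> 'a \<Rightarrow> 'a set"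
  where "residue p a = principal_ideal p +>\<^bsub>ring_of_type_algebra\<^esub> a"

text \<open>
  When \<open>(p)\<close> is stable under the involution, taking the image of a coset under \<open>bar\<close> is the
  induced involution on \<open>A/(p)\<close>.
\<close>

definition residue_bar :: "'a::involution_ring set \<Rightarrow> 'a set"
  where "residue_bar C = bar ` C"

definition tors_kernel ::
    "('a::comm_ring_1 \<Rightarrow> 't::ab_group_add \<Rightarrow> 't) \<Rightarrow> 'a \<Rightarrow> nat \<Rightarrow> 't set"
  where "tors_kernel scale p m = {x. scale (p ^ m) x = 0}"

definition aux_denom ::
    "('a::comm_ring_1 \<Rightarrow> 't::ab_group_add \<Rightarrow> 't) \<Rightarrow> 'a \<Rightarrow> nat \<Rightarrow> 't set"
  where "aux_denom scale p l =
    {x + scale p y | x y. x \<in> tors_kernel scale p (l - 1) \<and> y \<in> tors_kernel scale p (l + 1)}"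

text \<open>
  The \<open>mult\<close> and \<open>one\<close> fields of a module record play no role. The scalar product of cosets is
  formed like the product of cosets in \<^const>\<open>FactRing\<close>.
\<close>

definition aux_module ::
    "('a::comm_ring_1 \<Rightarrow> 't::ab_group_add \<Rightarrow> 't) \<Rightarrow> 'a \<Rightarrow> nat \<Rightarrow> ('a set, 't set) module"
  where "aux_module scale p l =
    \<lparr>carrier = (\<lambda>x. (+) x ` aux_denom scale p l) ` tors_kernel scale p l,
     monoid.mult = undefined, one = undefined,
     ring.zero = aux_denom scale p l,
     ring.add = (\<lambda>C D. {x + y | x y. x \<in> C \<and> y \<in> D}),
     module.smult = (\<lambda>R C. \<Union>r\<in>R. \<Union>x\<in>C. (+) (scale r x) ` aux_denom scale p l)\<rparr>"

text \<open>
  Since \<open>A/(p) \<rightarrow> S\<^sup>-\<^sup>1A/A\<close>, \<open>a \<mapsto> a/p\<close>, is injective, the set of all \<open>a\<close> such that \<open>a/p\<close> is a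
  given element of its image is a coset of \<open>(p)\<close>, namely the corresponding element of \<open>A/(p)\<close>.
\<close>

definition aux_form ::
    "('a::idom \<Rightarrow> 't::ab_group_add \<Rightarrow> 't) \<Rightarrow> ('t \<Rightarrow> 't \<Rightarrow> 'a fract_mod) \<Rightarrow> 'a \<Rightarrow> nat \<Rightarrow>
      't set \<Rightarrow> 't set \<Rightarrow> 'a set"
  where "aux_form scale lam p l C D =
    {a. \<exists>x\<in>C. \<exists>y\<in>D. fract_class a p = fract_mod_scale (p ^ (l - 1)) (lam x y)}"

end

theory Submission
  imports Defs
begin

text \<open>
  An isomorphism of linking forms preserves the kernels \<open>K\<^sub>l = ker p\<^sup>l\<close> and all pairings, hence the
  auxiliary forms; for this direction the work is to see that the \<open>\<Delta>\<^sub>l\<close> do carry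
  \<open>(u\<^sup>l\<epsilon>)\<close>-symmetric forms. Their nonsingularity rests on \<open>K\<^sub>l\<^sup>\<bottom> = p\<^sup>lT\<close>
  (\<open>orthogonal_tors_kernel\<close>), which follows from \<open>\<lambda>\<close> being onto the torsion dual once functionals
  on \<open>p\<^sup>lT\<close> are known to extend to \<open>T\<close>, that is, from the injectivity of \<open>K/A\<close>
  for the fraction field \<open>K\<close> of \<open>A\<close> (\<open>linear_on_extend\<close>).

  For the converse, pull \<open>\<lambda>'\<close> back along the module isomorphism, so that two forms \<open>\<lambda>\<close> and \<open>\<mu>\<close> with
  the same auxiliary forms live on the same module \<open>T\<close>. By nonsingularity of \<open>\<lambda>\<close> there is an
  endomorphism \<open>N\<close> with \<open>\<mu>(x, y) = \<lambda>(x + Nx, y)\<close>, and \<open>N\<close> is self-adjoint for \<open>\<lambda>\<close>, as both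
  forms are \<open>\<epsilon>\<close>-symmetric. Equality of the auxiliary forms says that \<open>Nx\<close> lies in the radical of
  \<open>p\<^sup>l\<^sup>-\<^sup>1\<lambda>\<close> on \<open>K\<^sub>l\<close> for \<open>x \<in> K\<^sub>l\<close>, so \<open>N\<close> induces \<open>0\<close> on every \<open>\<Delta>\<^sub>l\<close>
  (\<open>aux_form_radical\<close>). Such an \<open>N\<close> is nilpotent (\<open>nilpotent\<close>).

  It remains to write \<open>1 + N\<close> as \<open>g\<^sup>*g\<close>. A half-unit modulo \<open>p\<close> lifts to an element \<open>c\<close> with
  \<open>c + bar c = 1\<close> modulo the exponent \<open>p\<^sup>n\<close> of \<open>T\<close> (\<open>half_unit_lift\<close>). With it, the equation
  \<open>bar f \<cdot> f = 1 + X\<close> is solved for a power series \<open>f\<close> one coefficient at a time, \<open>c\<close> taking the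
  place of \<open>1/2\<close> (\<open>sqrt_coeff_convolution\<close>). The adjoint of the scalar \<open>a\<close> is \<open>bar a\<close>, so
  \<open>g = f(N)\<close>, a finite sum by nilpotency, satisfies \<open>\<lambda>(gx, gy) = \<mu>(x, y)\<close>
  (\<open>isometry_of_aux_forms_agree\<close>).
\<close>

section \<open>Principal ideals and the residue field\<close>

lemma bar_power: "bar (a ^ n) = bar a ^ n" for a :: "'a::involution_ring"
  by (induction n) (simp_all add: bar_one bar_mult)

lemma bar_sum: "bar (sum f A) = (\<Sum>a\<in>A. bar (f a))" for f :: "'b \<Rightarrow> 'a::involution_ring"
  by (induction A rule: infinite_finite_induct) (simp_all add: bar_add)

lemma principal_ideal_eq: "principal_ideal p = {a. p dvd a}"
  by (auto simp: principal_ideal_def cgenideal_def ring_of_type_algebra_def dvd_def mult.commute)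

lemma mem_residue: "b \<in> residue p a \<longleftrightarrow> p dvd b - a"
proof -
  have "b \<in> residue p a \<longleftrightarrow> (\<exists>k. b = p * k + a)"
    by (auto simp: residue_def principal_ideal_eq a_r_coset_def' ring_of_type_algebra_def dvd_def)
  also have "\<dots> \<longleftrightarrow> p dvd b - a"
    by (metis add_diff_cancel_right' diff_add_cancel dvdE dvd_triv_left)
  finally show ?thesis .
qed

lemma residue_eq_iff: "residue p a = residue p b \<longleftrightarrow> p dvd a - b"
proof
  assume "residue p a = residue p b"
  then show "p dvd a - b" by (metis diff_self dvd_0_right mem_residue)
next
  assume *: "p dvd a - b"
  have "p dvd x - a \<longleftrightarrow> p dvd x - b" for x
    using dvd_add_left_iff [OF *, of "x - a"] by simp
  then show "residue p a = residue p b" by (auto simp: mem_residue)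
qed

lemma ideal_principal_ideal: "ideal (principal_ideal p) ring_of_type_algebra"
  unfolding principal_ideal_def
  by (rule cring.cgenideal_ideal [OF cring_from_type_algebra]) (simp add: ring_of_type_algebra_def)

lemma carrier_residue_field: "carrier (residue_field p) = range (residue p)"
  by (auto simp: residue_field_def residue_def FactRing_def A_RCOSETS_def' ring_of_type_algebra_def)

lemma residue_in_carrier [simp]: "residue p a \<in> carrier (residue_field p)"
  by (simp add: carrier_residue_field)

lemma residue_add: "residue p a \<oplus>\<^bsub>residue_field p\<^esub> residue p b = residue p (a + b)"
  using ring_hom_add [OF ideal.rcos_ring_hom [OF ideal_principal_ideal], of a b p]
  by (simp add: residue_field_def residue_def ring_of_type_algebra_def)

lemma residue_mult: "residue p a \<otimes>\<^bsub>residue_field p\<^esub> residue p b = residue p (a * b)"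
  using ring_hom_mult [OF ideal.rcos_ring_hom [OF ideal_principal_ideal], of a b p]
  by (simp add: residue_field_def residue_def ring_of_type_algebra_def)

lemma residue_one: "\<one>\<^bsub>residue_field p\<^esub> = residue p 1"
  by (simp add: residue_field_def residue_def ring_of_type_algebra_def FactRing_def)

text \<open>
  Stability of \<open>(p)\<close> gives \<open>p dvd bar b\<close> if and only if \<open>p dvd b\<close>, so \<open>bar\<close> maps the coset of
  \<open>a\<close> onto, and not merely into, the coset of \<open>bar a\<close>.
\<close>

lemma residue_bar_residue:
  assumes "bar ` principal_ideal p = principal_ideal p"
  shows "residue_bar (residue p a) = residue p (bar a)"
proof -
  have *: "p dvd bar b \<longleftrightarrow> p dvd b" for b
    using assms unfolding principal_ideal_eq
    by (metis bar_bar image_eqI mem_Collect_eq)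
  have "b \<in> residue_bar (residue p a) \<longleftrightarrow> b \<in> residue p (bar a)" for b
  proof -
    have "b \<in> residue_bar (residue p a) \<longleftrightarrow> bar b \<in> residue p a"
      unfolding residue_bar_def by (metis bar_bar image_iff)
    then show ?thesis
      by (simp add: mem_residue) (metis * bar_bar bar_diff)
  qed
  then show ?thesis by blast
qed

lemma cring_residue_field: "cring (residue_field p)"
  unfolding residue_field_def
  by (rule ideal.quotient_is_cring [OF ideal_principal_ideal cring_from_type_algebra])

lemma field_residue_field:
  fixes p :: "'a::idom"
  assumes "principal_domain (ring_of_type_algebra :: 'a ring)" and "prime_elem p"
  shows "field (residue_field p)"
proof -
  interpret principal_domain "ring_of_type_algebra :: 'a ring" by fact
  have "ring_prime\<^bsub>ring_of_type_algebra\<^esub> p"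
    using assms(2)
    by (auto simp: ring_prime_def Divisibility.prime_def prime_elem_def factor_def properfactor_def
        ring_of_type_algebra_def Units_def dvd_def mult.commute)
  moreover have "p \<in> carrier ring_of_type_algebra - {\<zero>\<^bsub>ring_of_type_algebra\<^esub>}"
    using assms(2) by (auto simp: ring_of_type_algebra_def)
  ultimately show ?thesis
    unfolding residue_field_def principal_ideal_def using field_iff_prime by blast
qed

text \<open>
  A passage from ideals of a carrier to divisibility in the type, where the coefficient ideals
  arising from modules are treated.
\<close>

lemma principal_domain_generator:
  fixes I :: "'a::idom set"
  assumes "principal_domain (ring_of_type_algebra :: 'a ring)"
    and "0 \<in> I" and "\<And>a b. a \<in> I \<Longrightarrow> b \<in> I \<Longrightarrow> a + b \<in> I" and "\<And>a b. b \<in> I \<Longrightarrow> a * b \<in> I"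
  obtains d where "I = {a. d dvd a}"
proof -
  interpret principal_domain "ring_of_type_algebra :: 'a ring" by fact
  have "ideal I ring_of_type_algebra"
  proof (rule idealI)
    show "ring (ring_of_type_algebra :: 'a ring)" by (rule ring_axioms)
    have "- a \<in> I" if "a \<in> I" for a
      using assms(4) [OF that, of "- 1"] by simp
    moreover have "\<ominus>\<^bsub>ring_of_type_algebra\<^esub> a = - a" for a :: 'a
      by (rule minus_equality) (auto simp: ring_of_type_algebra_def)
    ultimately show "subgroup I (add_monoid ring_of_type_algebra)"
      using assms
      by unfold_locales (auto simp: ring_of_type_algebra_def a_inv_def)
    show "x \<otimes>\<^bsub>ring_of_type_algebra\<^esub> a \<in> I" "a \<otimes>\<^bsub>ring_of_type_algebra\<^esub> x \<in> I"
      if "a \<in> I" for a x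
      using assms(4) that by (auto simp: ring_of_type_algebra_def mult.commute)
  qed
  then obtain d where "I = principal_ideal d"
    using exists_gen unfolding principal_ideal_def by blast
  then show thesis using that by (simp add: principal_ideal_eq)
qed

section \<open>The module \<open>K/A\<close>\<close>

interpretation fract_mod: Modules.module fract_mod_scale
proof
  have *: "0 \<in> range (\<lambda>a::'a. Fract a 1)" by (auto simp: Zero_fract_def)
  fix a b :: 'a and x y :: "'a fract_mod"
  show "fract_mod_scale a (x + y) = fract_mod_scale a x + fract_mod_scale a y"
    by transfer (simp add: distrib_left *)
  show "fract_mod_scale (a + b) x = fract_mod_scale a x + fract_mod_scale b x"
  proof transfer
    fix a b :: 'a and x :: "'a fract"
    have "Fract (a + b) 1 = Fract a 1 + Fract b 1" by simp
    then have "Fract (a + b) 1 * x - (Fract a 1 * x + Fract b 1 * x) = 0"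
      by (simp only: distrib_right) simp
    with * show "Fract (a + b) 1 * x - (Fract a 1 * x + Fract b 1 * x) \<in> range (\<lambda>a. Fract a 1)"
      by simp
  qed
  show "fract_mod_scale a (fract_mod_scale b x) = fract_mod_scale (a * b) x"
    by transfer (simp add: * mult.assoc [symmetric])
  show "fract_mod_scale 1 x = x"
    by transfer (simp add: * One_fract_def [symmetric])
qed

lemma fract_class_eq_0_iff:
  assumes "b \<noteq> 0"
  shows "fract_class a b = 0 \<longleftrightarrow> b dvd a"
  using assms by transfer (auto simp: eq_fract dvd_def mult.commute)

lemma fract_class_add:
  assumes "b \<noteq> 0"
  shows "fract_class a b + fract_class a' b = fract_class (a + a') b"
proof -
  have "Fract a b + Fract a' b = Fract (a + a') b"
    using assms by (simp add: eq_fract algebra_simps)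
  then show ?thesis
    unfolding fract_class_def map_fun_def comp_def id_def plus_fract_mod.abs_eq by simp
qed

lemma fract_class_scale: "fract_mod_scale c (fract_class a b) = fract_class (c * a) b"
  by transfer (auto simp: Zero_fract_def)

lemma fract_class_mult_cancel: "c \<noteq> 0 \<Longrightarrow> fract_class (c * a) (c * b) = fract_class a b"
  by transfer (auto simp: Zero_fract_def mult_fract_cancel)

lemma fract_class_eq_iff:
  assumes "b \<noteq> 0"
  shows "fract_class a b = fract_class a' b \<longleftrightarrow> b dvd a - a'"
proof -
  have "fract_class a b = fract_class (a - a') b + fract_class a' b"
    using assms by (simp add: fract_class_add)
  then show ?thesis using fract_class_eq_0_iff [OF assms] by auto
qed

lemma fract_class_cases:
  obtains a b where "q = fract_class a b" "b \<noteq> 0"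
proof -
  have "\<exists>a b. q = fract_class a b \<and> b \<noteq> 0"
  proof transfer
    fix q :: "'a fract"
    obtain a b where "q = Fract a b" "b \<noteq> 0" by (rule Fract_cases)
    then show "\<exists>a b. q - Fract a b \<in> range (\<lambda>a. Fract a 1) \<and> b \<noteq> 0"
      by (intro exI [of _ a] exI [of _ b]) (simp add: image_iff, metis Zero_fract_def)
  qed
  then show thesis using that by blast
qed

text \<open>
  Divisibility is what makes \<open>K/A\<close> an injective module over a principal ideal domain.
\<close>

lemma fract_mod_divisible:
  assumes "d \<noteq> 0"
  obtains q' where "fract_mod_scale d q' = q"
proof -
  obtain a b where "q = fract_class a b" by (rule fract_class_cases)
  then have "fract_mod_scale d (fract_class a (d * b)) = q"
    using assms by (simp add: fract_class_scale fract_class_mult_cancel)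
  then show thesis by (rule that)
qed

text \<open>
  Applied with \<open>s = p\<^sup>n\<close>: a functional on a module killed by \<open>p\<^sup>n\<close> takes its values in
  \<open>S\<^sup>-\<^sup>1A/A\<close>, so it can be extended in \<open>K/A\<close>.
\<close>

lemma fract_mod_torsion:
  assumes "s \<noteq> 0" and "fract_mod_scale s q = 0"
  obtains a where "q = fract_class a s"
proof -
  obtain a b where q: "q = fract_class a b" "b \<noteq> 0" by (rule fract_class_cases)
  with assms have "b dvd s * a" by (simp add: fract_class_scale fract_class_eq_0_iff)
  then obtain c where "s * a = b * c" by (elim dvdE)
  then have "fract_class (s * a) (s * b) = fract_class (b * c) (b * s)"
    by (simp add: mult.commute)
  with q assms have "q = fract_class c s" by (simp add: fract_class_mult_cancel)
  then show thesis by (rule that)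
qed

lemma bar_fract_mod_fract_class: "bar_fract_mod (fract_class a b) = fract_class (bar a) (bar b)"
  by transfer (auto simp: Zero_fract_def)

lemma bar_fract_mod_scale:
  "bar_fract_mod (fract_mod_scale a q) = fract_mod_scale (bar a) (bar_fract_mod q)"
  by (rule fract_class_cases [of q])
     (simp add: fract_class_scale bar_fract_mod_fract_class bar_mult)

lemma bar_fract_mod_diff: "bar_fract_mod (q - r) = bar_fract_mod q - bar_fract_mod r"
  unfolding minus_fract_mod_def
proof transfer
  fix q r :: "'a fract"
  have "bar_fract (q + - r) = bar_fract q + - bar_fract r"
    using bar_fract_diff [of q r] by simp
  then show "bar_fract (q + - r) - (bar_fract q + - bar_fract r) \<in> range (\<lambda>a. Fract a 1)"
    by (auto simp: Zero_fract_def)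
qed

section \<open>Modules over a principal ideal domain\<close>

text \<open>
  Functionals on submodules are total functions, so that the domain can grow in an induction
  without a change of type.
\<close>

definition linear_on ::
    "('a::idom \<Rightarrow> 't::ab_group_add \<Rightarrow> 't) \<Rightarrow> 't set \<Rightarrow> ('t \<Rightarrow> 'a fract_mod) \<Rightarrow> bool"
  where "linear_on scale P f \<longleftrightarrow>
    (\<forall>x\<in>P. \<forall>y\<in>P. f (x + y) = f x + f y) \<and>
    (\<forall>a. \<forall>x\<in>P. f (scale a x) = fract_mod_scale a (f x))"

locale pid_module = Modules.module scale
  for scale :: "'a::idom \<Rightarrow> 't::ab_group_add \<Rightarrow> 't" +
  assumes pid: "principal_domain (ring_of_type_algebra :: 'a ring)"
begin

text \<open>
  One step of Baer's criterion. The scalars \<open>a\<close> with \<open>a t \<in> P\<close> form an ideal \<open>(d)\<close>; a functional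
  \<open>f\<close> on \<open>P\<close> extends to \<open>P + A t\<close> with value \<open>q\<close> at \<open>t\<close> as soon as \<open>d q = f (d t)\<close>, and such a
  \<open>q\<close> exists because \<open>K/A\<close> is divisible.
\<close>

lemma linear_on_extend_insert:
  assumes P: "subspace P" and f: "linear_on scale P f"
  shows "\<exists>g. linear_on scale (span (insert t P)) g \<and> (\<forall>x\<in>P. g x = f x)"
proof -
  have f_add: "f (x + y) = f x + f y" if "x \<in> P" "y \<in> P" for x y
    using f that by (auto simp: linear_on_def)
  have f_scale: "f (scale a x) = fract_mod_scale a (f x)" if "x \<in> P" for a x
    using f that by (auto simp: linear_on_def)
  have "scale (a * b) t \<in> P" if "scale b t \<in> P" for a b
    using subspace_scale [OF P that, of a] by simp
  then obtain d where d: "{a. scale a t \<in> P} = {a. d dvd a}"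
    using principal_domain_generator [OF pid, of "{a. scale a t \<in> P}"]
    by (auto simp: scale_left_distrib subspace_0 [OF P] subspace_add [OF P])
  have "d \<in> {a. scale a t \<in> P}" unfolding d by simp
  then have dt: "scale d t \<in> P" by simp
  obtain q where q: "fract_mod_scale d q = f (scale d t)"
  \<comment> \<open>For \<open>d = 0\<close> the submodules \<open>P\<close> and \<open>A t\<close> are independent and any value will do.\<close>
  proof (cases "d = 0")
    case True
    have "f 0 = 0" using f_scale [OF subspace_0 [OF P], of 0] by simp
    with True show thesis using that [of 0] by simp
  next
    case False
    then show thesis using fract_mod_divisible that by metis
  qed
  have f_t: "f (scale a t) = fract_mod_scale a q" if "scale a t \<in> P" for a
  proof -
    from that have "a \<in> {a. scale a t \<in> P}" by simp
    then have "d dvd a" unfolding d by simp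
    then obtain b where b: "a = b * d" by (metis dvd_def mult.commute)
    then have "f (scale a t) = fract_mod_scale b (f (scale d t))"
      using f_scale [OF dt, of b] by simp
    then show ?thesis using b by (simp flip: q)
  qed
  define g where
    "g x = (let k = SOME k. x - scale k t \<in> P in f (x - scale k t) + fract_mod_scale k q)" for x
  have g: "g x = f (x - scale k t) + fract_mod_scale k q" if k: "x - scale k t \<in> P" for x k
  proof -
    define k' where "k' = (SOME k. x - scale k t \<in> P)"
    have k': "x - scale k' t \<in> P" unfolding k'_def using k by (rule someI)
    have "scale (k' - k) t = (x - scale k t) - (x - scale k' t)"
      by (simp add: scale_left_diff_distrib)
    then have *: "scale (k' - k) t \<in> P" using subspace_diff [OF P k k'] by simp
    have "f (x - scale k t) = f ((x - scale k' t) + scale (k' - k) t)"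
      by (simp add: scale_left_diff_distrib)
    also have "\<dots> = f (x - scale k' t) + fract_mod_scale (k' - k) q"
      using f_add [OF k' *] f_t [OF *] by simp
    finally show ?thesis
      by (simp add: g_def Let_def k'_def fract_mod.scale_left_diff_distrib)
  qed
  have span_P: "x \<in> span (insert t P) \<longleftrightarrow> (\<exists>k. x - scale k t \<in> P)" for x
    unfolding span_breakdown_eq span_eq_iff [THEN iffD2, OF P] ..
  have "linear_on scale (span (insert t P)) g"
    unfolding linear_on_def
  proof (intro conjI ballI allI)
    fix x y assume "x \<in> span (insert t P)" "y \<in> span (insert t P)"
    then obtain k m where k: "x - scale k t \<in> P" and m: "y - scale m t \<in> P"
      unfolding span_P by blast
    have eq: "x + y - scale (k + m) t = (x - scale k t) + (y - scale m t)"
      by (simp add: scale_left_distrib)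
    have km: "x + y - scale (k + m) t \<in> P" unfolding eq by (rule subspace_add [OF P k m])
    show "g (x + y) = g x + g y"
      unfolding g [OF k] g [OF m] g [OF km] eq f_add [OF k m]
      by (simp add: fract_mod.scale_left_distrib)
  next
    fix a x assume "x \<in> span (insert t P)"
    then obtain k where k: "x - scale k t \<in> P" unfolding span_P by blast
    have eq: "scale a x - scale (a * k) t = scale a (x - scale k t)"
      by (simp add: scale_right_diff_distrib)
    have ak: "scale a x - scale (a * k) t \<in> P" unfolding eq by (rule subspace_scale [OF P k])
    show "g (scale a x) = fract_mod_scale a (g x)"
      unfolding g [OF k] g [OF ak] eq f_scale [OF k]
      by (simp add: fract_mod.scale_right_distrib)
  qed
  moreover have "g x = f x" if "x \<in> P" for x
    using g [of x 0] that by simp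
  ultimately show ?thesis by blast
qed

lemma linear_on_extend:
  assumes P: "subspace P" and f: "linear_on scale P f" and B: "finite B" "span B = UNIV"
  shows "\<exists>g. module_hom scale fract_mod_scale g \<and> (\<forall>x\<in>P. g x = f x)"
proof -
  have "\<exists>g. linear_on scale (span (P \<union> B)) g \<and> (\<forall>x\<in>P. g x = f x)"
    using B(1)
  proof induction
    case empty
    then show ?case using f by (auto simp: span_eq_iff [THEN iffD2, OF P])
  next
    case (insert t B)
    then obtain g where g: "linear_on scale (span (P \<union> B)) g" "\<forall>x\<in>P. g x = f x" by blast
    have "span (insert t (span (P \<union> B))) = span (P \<union> insert t B)"
      by (simp add: set_eq_iff span_breakdown_eq span_span)
    with linear_on_extend_insert [OF subspace_span g(1), of t]
    obtain g' where g': "linear_on scale (span (P \<union> insert t B)) g'"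
        "\<forall>x\<in>span (P \<union> B). g' x = g x"
      by auto
    then have "\<forall>x\<in>P. g' x = f x" using g(2) by (simp add: span_base)
    with g' show ?case by blast
  qed
  then obtain g where g: "linear_on scale (span (P \<union> B)) g" "\<forall>x\<in>P. g x = f x" by blast
  moreover have "span (P \<union> B) = UNIV"
    using span_mono [of B "P \<union> B"] B(2) by auto
  ultimately have "module_hom scale fract_mod_scale g"
    by (auto simp: linear_on_def module_hom_iff module_axioms fract_mod.module_axioms)
  with g(2) show ?thesis by blast
qed

text \<open>
  Induction on the generators: the coefficients at \<open>t\<close> of the elements of \<open>N\<close> form an ideal
  \<open>(d)\<close>, and any element of \<open>N\<close> with coefficient \<open>d\<close>, together with generators of
  \<open>N \<inter> span B\<close>, generates \<open>N\<close>.
\<close>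

lemma subspace_finitely_generated:
  assumes B: "finite B" and N: "subspace N" "N \<subseteq> span B"
  shows "\<exists>C. finite C \<and> span C = N"
  using B N
proof (induction arbitrary: N)
  case empty
  then show ?case by (intro exI [of _ "{}"]) (auto dest: subspace_0)
next
  case (insert t B)
  obtain C where C: "finite C" "span C = N \<inter> span B"
    using insert.IH [of "N \<inter> span B"] insert.prems(1) by (auto simp: subspace_inter)
  define I where "I = {a. \<exists>w\<in>span B. scale a t + w \<in> N}"
  have "\<exists>d. I = {a. d dvd a}"
  proof (rule principal_domain_generator [OF pid])
    show "0 \<in> I"
      unfolding I_def using subspace_0 [OF insert.prems(1)] span_zero by auto
    show "a + b \<in> I" if "a \<in> I" "b \<in> I" for a b
    proof -
      from that obtain v w where vw: "v \<in> span B" "w \<in> span B" "scale a t + v \<in> N" "scale b t + w \<in> N"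
        by (auto simp: I_def)
      have "scale (a + b) t + (v + w) = (scale a t + v) + (scale b t + w)"
        by (simp add: scale_left_distrib)
      then have "scale (a + b) t + (v + w) \<in> N"
        using subspace_add [OF insert.prems(1) vw(3,4)] by metis
      then show ?thesis using span_add [OF vw(1,2)] by (auto simp: I_def)
    qed
    show "a * b \<in> I" if "b \<in> I" for a b
    proof -
      from that obtain w where w: "w \<in> span B" "scale b t + w \<in> N" by (auto simp: I_def)
      have "scale (a * b) t + scale a w \<in> N"
        using subspace_scale [OF insert.prems(1) w(2), of a] by (simp add: scale_right_distrib)
      then show ?thesis using span_scale [OF w(1)] by (auto simp: I_def)
    qed
  qed blast
  then obtain d where d: "I = {a. d dvd a}" by blast
  then have "d \<in> I" by simp
  then obtain w where w: "w \<in> span B" "scale d t + w \<in> N" by (auto simp: I_def)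
  define n where "n = scale d t + w"
  have "span (insert n C) = N"
  proof (rule span_unique)
    show "insert n C \<subseteq> N" using w(2) C(2) span_superset [of C] by (auto simp: n_def)
    show "subspace N" by fact
    fix N' assume N': "insert n C \<subseteq> N'" "subspace N'"
    show "N \<subseteq> N'"
    proof
      fix x assume x: "x \<in> N"
      then obtain k where k: "x - scale k t \<in> span B"
        using insert.prems(2) span_breakdown_eq by blast
      then have "k \<in> I" unfolding I_def using x by (auto intro!: bexI [of _ "x - scale k t"])
      then have "d dvd k" by (simp add: d)
      then obtain b where b: "k = b * d" by (metis dvd_def mult.commute)
      have "x - scale b n = (x - scale k t) - scale b w"
        by (simp add: n_def b scale_right_distrib)
      then have "x - scale b n \<in> span B" using span_diff [OF k span_scale [OF w(1)]] by metis
      moreover have "x - scale b n \<in> N"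
        using subspace_diff subspace_scale insert.prems(1) x w(2) by (simp add: n_def)
      ultimately have "x - scale b n \<in> span C" using C(2) by blast
      then have "x - scale b n \<in> N'" using span_minimal [of C N'] N' by auto
      then have "(x - scale b n) + scale b n \<in> N'"
        using N' by (intro subspace_add subspace_scale) auto
      then show "x \<in> N'" by simp
    qed
  qed
  then show ?case using C(1) by (intro exI [of _ "insert n C"]) simp
qed

end

section \<open>Linking forms\<close>

context Modules.module
begin

lemma mem_tors_kernel: "x \<in> tors_kernel scale p m \<longleftrightarrow> scale (p ^ m) x = 0"
  by (simp add: tors_kernel_def)

lemma subspace_tors_kernel: "subspace (tors_kernel scale p m)"
  unfolding tors_kernel_def
  by (rule module_hom.subspace_kernel [OF module_hom_scale_self])

lemma tors_kernel_mono:
  assumes "m \<le> n" shows "tors_kernel scale p m \<subseteq> tors_kernel scale p n"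
proof
  fix x assume "x \<in> tors_kernel scale p m"
  moreover have "p ^ n = p ^ (n - m) * p ^ m"
    using assms by (simp flip: power_add)
  then have "scale (p ^ n) x = scale (p ^ (n - m)) (scale (p ^ m) x)" by simp
  ultimately show "x \<in> tors_kernel scale p n" by (simp add: mem_tors_kernel del: scale_scale)
qed

lemma subspace_scaled_image:
  assumes "subspace P"
  shows "subspace (scale a ` P)"
proof -
  show ?thesis by (rule module_hom.subspace_image [OF module_hom_scale_self assms])
qed

end

locale linking = pid_module scale
  for scale :: "'a::{idom, involution_ring} \<Rightarrow> 't::ab_group_add \<Rightarrow> 't" +
  fixes S :: "'a set" and \<epsilon> :: 'a and lam :: "'t \<Rightarrow> 't \<Rightarrow> 'a fract_mod"
  assumes form: "linking_form S \<epsilon> scale lam"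
begin

lemma lam_hom: "module_hom scale fract_mod_scale (lam x)"
  using form unfolding linking_form_def torsion_dual_def by blast

lemma lam_add_right: "lam x (y + y') = lam x y + lam x y'"
  by (rule module_hom.add [OF lam_hom])

lemma lam_scale_right: "lam x (scale a y) = fract_mod_scale a (lam x y)"
  by (rule module_hom.scale [OF lam_hom])

lemma lam_zero_right [simp]: "lam x 0 = 0"
  by (rule module_hom.zero [OF lam_hom])

lemma lam_sum_right: "lam x (sum g A) = (\<Sum>a\<in>A. lam x (g a))"
  by (rule module_hom.sum [OF lam_hom])

lemma lam_add_left: "lam (x + x') y = lam x y + lam x' y"
  using form unfolding linking_form_def by blast

lemma lam_scale_left: "lam (scale a x) y = fract_mod_scale (bar a) (lam x y)"
  using form unfolding linking_form_def by blast

sublocale left: additive "\<lambda>x. lam x y"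
  by standard (rule lam_add_left)

lemma lam_sym: "lam x y = fract_mod_scale \<epsilon> (bar_fract_mod (lam y x))"
  using form unfolding linking_form_def by blast

lemma lam_inj: "(\<And>y. lam x y = lam x' y) \<Longrightarrow> x = x'"
proof (rule injD)
  show "inj lam" using form unfolding linking_form_def by blast
qed (rule ext)

lemma finitely_generated: "\<exists>B. finite B \<and> span B = UNIV"
  using form unfolding linking_form_def by blast

lemma torsion: "\<exists>s\<in>S. scale s x = 0"
  using form unfolding linking_form_def by blast

end

locale nonsingular_linking = linking scale "prime_powers p" \<epsilon> lam
  for scale :: "'a::{idom, involution_ring} \<Rightarrow> 't::ab_group_add \<Rightarrow> 't" and p \<epsilon> lam +
  fixes u :: 'a
  assumes prime: "prime_elem p"
    and p_bar: "bar ` principal_ideal p = principal_ideal p"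
    and u: "p = u * bar p"
    and nonsingular: "range lam = torsion_dual (prime_powers p) scale"
begin

abbreviation K where "K \<equiv> tors_kernel scale p"

lemma p_nonzero [simp]: "p \<noteq> 0"
  using prime by auto

lemma bar_p: "bar p = bar u * p"
proof -
  have "bar p = bar (u * bar p)" by (rule arg_cong [OF u])
  then show ?thesis by (simp only: bar_mult bar_bar)
qed

lemma bar_p_power: "bar (p ^ k) = bar u ^ k * p ^ k"
  by (simp add: bar_power bar_p power_mult_distrib)

lemma u_bar_u: "u * bar u = 1"
proof -
  have "(u * bar u) * p = u * bar p" by (simp only: bar_p mult.assoc)
  also have "\<dots> = 1 * p" by (simp only: u [symmetric] mult_1)
  finally show ?thesis by (simp only: mult_right_cancel [OF p_nonzero])
qed

text \<open>
  Each element is killed by some power of \<open>p\<close>, as the unit in an element of \<open>p\<^sup>\<infinity>\<close> can be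
  cancelled, and finitely many generators have a common exponent.
\<close>

lemma exponent: "\<exists>n. \<forall>x. scale (p ^ n) x = 0"
proof -
  have "\<exists>k. scale (p ^ k) x = 0" for x
  proof -
    obtain v k where v: "v dvd 1" "scale (v * p ^ k) x = 0"
      using torsion [of x] by (auto simp: prime_powers_def)
    then obtain w where "1 = v * w" by (elim dvdE)
    then have "p ^ k = w * (v * p ^ k)" by (metis mult.assoc mult.commute mult_1)
    then have "scale (p ^ k) x = scale w (scale (v * p ^ k) x)" by (simp only: scale_scale)
    with v show ?thesis by (intro exI [of _ k]) simp
  qed
  then obtain k where k: "scale (p ^ k x) x = 0" for x by metis
  obtain B where B: "finite B" "span B = UNIV" using finitely_generated by blast
  define n where "n = (\<Sum>b\<in>B. k b)"
  have "B \<subseteq> K n"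
  proof
    fix b assume "b \<in> B"
    then have "k b \<le> n" unfolding n_def using B(1) by (intro member_le_sum) auto
    moreover have "b \<in> K (k b)" using k by (simp add: mem_tors_kernel)
    ultimately show "b \<in> K n" using tors_kernel_mono by blast
  qed
  then have "span B \<subseteq> K n" by (rule span_minimal) (rule subspace_tors_kernel)
  then have "x \<in> K n" for x using B(2) by blast
  then show ?thesis by (auto simp: mem_tors_kernel)
qed

lemma represent:
  assumes f: "module_hom scale fract_mod_scale f"
  shows "\<exists>x. lam x = f"
proof -
  obtain n where n: "\<And>x. scale (p ^ n) x = 0" using exponent by blast
  have "f y \<in> loc_quot (prime_powers p)" for y
  proof -
    have "fract_mod_scale (p ^ n) (f y) = 0"
      using module_hom.scale [OF f, of "p ^ n" y] by (simp add: n module_hom.zero [OF f])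
    then obtain a where "f y = fract_class a (p ^ n)"
      using fract_mod_torsion [of "p ^ n"] by auto
    moreover have "p ^ n \<in> prime_powers p"
      unfolding prime_powers_def by (auto intro!: exI [of _ 1] exI [of _ n])
    ultimately show ?thesis unfolding loc_quot_def by blast
  qed
  with f have "f \<in> torsion_dual (prime_powers p) scale" by (auto simp: torsion_dual_def)
  then show ?thesis using nonsingular by (metis imageE)
qed

text \<open>
  Moving \<open>p\<^sup>k\<close> to the first argument conjugates it, and \<open>bar p\<close> is a unit multiple of \<open>p\<close>.
\<close>

lemma lam_power_shift:
  "fract_mod_scale (p ^ k) (lam x y) = lam (scale (bar u ^ k) (scale (p ^ k) x)) y"
proof -
  have "lam (scale (bar u ^ k) (scale (p ^ k) x)) y = lam (scale (bar (p ^ k)) x) y"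
    by (simp add: bar_p_power)
  then show ?thesis by (simp only: lam_scale_left bar_bar)
qed

text \<open>
  If \<open>\<lambda>(x, -)\<close> vanishes on \<open>K\<^sub>l\<close>, it factors through multiplication by \<open>p\<^sup>l\<close> and so
  defines a functional on \<open>p\<^sup>lT\<close>. An extension to \<open>T\<close> has the form \<open>\<lambda>(z, -)\<close>, which gives
  \<open>\<lambda>(x, y) = \<lambda>(z, p\<^sup>l y)\<close> for all \<open>y\<close> and identifies \<open>x\<close> with a unit multiple of \<open>p\<^sup>l z\<close>.
\<close>

lemma orthogonal_tors_kernel:
  assumes "\<And>y. y \<in> K l \<Longrightarrow> lam x y = 0"
  shows "\<exists>z. x = scale (p ^ l) z"
proof -
  define P where "P = range (scale (p ^ l))"
  have P: "subspace P" unfolding P_def by (rule subspace_scaled_image) simp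
  have same: "lam x y = lam x y'" if "scale (p ^ l) y = scale (p ^ l) y'" for y y'
  proof -
    have "y - y' \<in> K l" using that by (simp add: mem_tors_kernel scale_right_diff_distrib)
    with assms have "lam x (y - y') = 0" by simp
    then show ?thesis by (simp add: module_hom.diff [OF lam_hom])
  qed
  define f where "f w = lam x (SOME y. scale (p ^ l) y = w)" for w
  have f: "f (scale (p ^ l) y) = lam x y" for y
    unfolding f_def by (rule same) (rule someI [of _ y], simp)
  have "linear_on scale P f"
    unfolding linear_on_def
  proof (intro conjI ballI allI)
    fix v w assume "v \<in> P" "w \<in> P"
    then obtain y z where "v = scale (p ^ l) y" "w = scale (p ^ l) z" by (auto simp: P_def)
    then show "f (v + w) = f v + f w"
      using f [of "y + z"] by (simp add: f scale_right_distrib lam_add_right)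
  next
    fix a v assume "v \<in> P"
    then obtain y where v: "v = scale (p ^ l) y" by (auto simp: P_def)
    then have "scale a v = scale (p ^ l) (scale a y)" by (simp add: mult.commute)
    then show "f (scale a v) = fract_mod_scale a (f v)"
      unfolding v by (simp only: f lam_scale_right)
  qed
  then obtain g where g: "module_hom scale fract_mod_scale g" "\<And>w. w \<in> P \<Longrightarrow> g w = f w"
    using linear_on_extend [OF P] finitely_generated by metis
  then obtain z where z: "lam z = g" using represent by blast
  have "x = scale (bar u ^ l) (scale (p ^ l) z)"
  proof (rule lam_inj)
    fix y
    have "lam x y = g (scale (p ^ l) y)" using g(2) f by (simp add: P_def)
    also have "\<dots> = fract_mod_scale (p ^ l) (lam z y)" unfolding z [symmetric] by (rule lam_scale_right)
    finally show "lam x y = lam (scale (bar u ^ l) (scale (p ^ l) z)) y"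
      by (simp only: lam_power_shift)
  qed
  also have "\<dots> = scale (p ^ l) (scale (bar u ^ l) z)" by (rule scale_left_commute)
  finally show ?thesis by blast
qed

end

section \<open>Auxiliary modules\<close>

definition aux_coset ::
    "('a::comm_ring_1 \<Rightarrow> 't::ab_group_add \<Rightarrow> 't) \<Rightarrow> 'a \<Rightarrow> nat \<Rightarrow> 't \<Rightarrow> 't set"
  where "aux_coset scale p l x = (+) x ` aux_denom scale p l"

context Modules.module
begin

lemma subspace_aux_denom: "subspace (aux_denom scale p l)"
proof -
  have "aux_denom scale p l = span (tors_kernel scale p (l - 1) \<union> scale p ` tors_kernel scale p (l + 1))"
    unfolding span_Un span_eq_iff [THEN iffD2, OF subspace_tors_kernel]
      span_eq_iff [THEN iffD2, OF subspace_scaled_image [OF subspace_tors_kernel]]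
    by (auto simp: aux_denom_def)
  then show ?thesis by simp
qed

lemma aux_denom_subset:
  assumes "l > 0"
  shows "aux_denom scale p l \<subseteq> tors_kernel scale p l"
proof
  fix d assume "d \<in> aux_denom scale p l"
  then obtain x y where d: "d = x + scale p y"
    and x: "x \<in> tors_kernel scale p (l - 1)" and y: "y \<in> tors_kernel scale p (l + 1)"
    by (auto simp: aux_denom_def)
  have "x \<in> tors_kernel scale p l" using x tors_kernel_mono [of "l - 1" l p] by auto
  moreover have "scale p y \<in> tors_kernel scale p l"
    using y by (simp add: mem_tors_kernel mult.commute)
  ultimately show "d \<in> tors_kernel scale p l"
    unfolding d by (rule subspace_add [OF subspace_tors_kernel])
qed

text \<open>
  This is why multiplication by \<open>p\<close> is zero on \<open>\<Delta>\<^sub>l\<close>, which makes \<open>\<Delta>\<^sub>l\<close> an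
  \<open>A/(p)\<close>-module.
\<close>

lemma scale_mem_aux_denom:
  assumes "x \<in> tors_kernel scale p l"
  shows "scale p x \<in> aux_denom scale p l"
proof -
  have "x \<in> tors_kernel scale p (l + 1)"
    using assms tors_kernel_mono [of l "l + 1" p] by auto
  then have "0 + scale p x \<in> aux_denom scale p l"
    unfolding aux_denom_def using subspace_0 [OF subspace_tors_kernel, of p "l - 1"] by blast
  then show ?thesis by simp
qed

lemma mem_aux_coset: "y \<in> aux_coset scale p l x \<longleftrightarrow> y - x \<in> aux_denom scale p l"
  unfolding aux_coset_def by (force simp: image_iff)

lemma mem_aux_coset_self: "x \<in> aux_coset scale p l x"
  by (simp add: mem_aux_coset subspace_0 [OF subspace_aux_denom])

lemma aux_coset_subset:
  assumes "l > 0" and "x \<in> tors_kernel scale p l"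
  shows "aux_coset scale p l x \<subseteq> tors_kernel scale p l"
proof
  fix y assume "y \<in> aux_coset scale p l x"
  then have "y - x \<in> tors_kernel scale p l"
    using aux_denom_subset [OF assms(1)] by (auto simp: mem_aux_coset)
  from subspace_add [OF subspace_tors_kernel this assms(2)]
  show "y \<in> tors_kernel scale p l" by simp
qed

lemma aux_coset_eq_iff:
  "aux_coset scale p l x = aux_coset scale p l y \<longleftrightarrow> x - y \<in> aux_denom scale p l"
proof
  assume "aux_coset scale p l x = aux_coset scale p l y"
  then show "x - y \<in> aux_denom scale p l" using mem_aux_coset mem_aux_coset_self by blast
next
  assume d: "x - y \<in> aux_denom scale p l"
  have "z - x \<in> aux_denom scale p l \<longleftrightarrow> z - y \<in> aux_denom scale p l" for z
    using subspace_add [OF subspace_aux_denom _ d, of "z - x"]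
      subspace_diff [OF subspace_aux_denom _ d, of "z - y"] by auto
  then show "aux_coset scale p l x = aux_coset scale p l y"
    by (simp add: set_eq_iff mem_aux_coset)
qed

lemma carrier_aux_module:
  "carrier (aux_module scale p l) = aux_coset scale p l ` tors_kernel scale p l"
  by (simp add: aux_module_def aux_coset_def)

lemma aux_coset_in_carrier:
  "x \<in> tors_kernel scale p l \<Longrightarrow> aux_coset scale p l x \<in> carrier (aux_module scale p l)"
  by (simp add: carrier_aux_module)

lemma aux_zero: "\<zero>\<^bsub>aux_module scale p l\<^esub> = aux_coset scale p l 0"
  by (simp add: aux_module_def aux_coset_def)

lemma aux_add:
  "aux_coset scale p l x \<oplus>\<^bsub>aux_module scale p l\<^esub> aux_coset scale p l y = aux_coset scale p l (x + y)"
proof -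
  have "z \<in> aux_coset scale p l (x + y) \<longleftrightarrow>
    (\<exists>v w. z = v + w \<and> v \<in> aux_coset scale p l x \<and> w \<in> aux_coset scale p l y)" for z
  proof
    assume "z \<in> aux_coset scale p l (x + y)"
    then have "z - y \<in> aux_coset scale p l x" by (simp add: mem_aux_coset algebra_simps)
    moreover have "z = (z - y) + y" by simp
    ultimately show "\<exists>v w. z = v + w \<and> v \<in> aux_coset scale p l x \<and> w \<in> aux_coset scale p l y"
      using mem_aux_coset_self by blast
  next
    assume "\<exists>v w. z = v + w \<and> v \<in> aux_coset scale p l x \<and> w \<in> aux_coset scale p l y"
    then obtain v w where z: "z = v + w"
      and "v - x \<in> aux_denom scale p l" "w - y \<in> aux_denom scale p l"
      by (auto simp: mem_aux_coset)
    then have "(v - x) + (w - y) \<in> aux_denom scale p l"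
      by (intro subspace_add [OF subspace_aux_denom])
    then show "z \<in> aux_coset scale p l (x + y)"
      by (simp add: mem_aux_coset z algebra_simps)
  qed
  then show ?thesis by (auto simp: aux_module_def set_eq_iff)
qed

text \<open>
  The scalar product of cosets is a union over all representatives; all of them contribute the same
  coset, since changing \<open>r\<close> by a multiple of \<open>p\<close> or \<open>y\<close> by an element of the denominator changes
  \<open>r y\<close> by an element of the denominator.
\<close>

lemma aux_smult:
  assumes "l > 0" and x: "x \<in> tors_kernel scale p l"
  shows "residue p a \<odot>\<^bsub>aux_module scale p l\<^esub> aux_coset scale p l x = aux_coset scale p l (scale a x)"
proof -
  have eq: "aux_coset scale p l (scale r y) = aux_coset scale p l (scale a x)"
    if "r \<in> residue p a" "y \<in> aux_coset scale p l x" for r y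
  proof -
    from that(1) obtain k where k: "r - a = p * k" by (auto simp: mem_residue dvd_def)
    have "y \<in> tors_kernel scale p l" using aux_coset_subset assms that(2) by blast
    then have "scale k y \<in> tors_kernel scale p l"
      by (rule subspace_scale [OF subspace_tors_kernel])
    then have "scale p (scale k y) \<in> aux_denom scale p l" by (rule scale_mem_aux_denom)
    moreover have "scale a (y - x) \<in> aux_denom scale p l"
      using that(2) by (intro subspace_scale [OF subspace_aux_denom]) (simp add: mem_aux_coset)
    ultimately have "scale p (scale k y) + scale a (y - x) \<in> aux_denom scale p l"
      by (rule subspace_add [OF subspace_aux_denom])
    moreover have "scale p (scale k y) + scale a (y - x) = scale r y - scale a x"
      by (simp add: scale_right_diff_distrib flip: k) (simp add: scale_left_diff_distrib)
    ultimately show ?thesis by (simp add: aux_coset_eq_iff)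
  qed
  have "residue p a \<odot>\<^bsub>aux_module scale p l\<^esub> aux_coset scale p l x =
      (\<Union>r\<in>residue p a. \<Union>y\<in>aux_coset scale p l x. aux_coset scale p l (scale r y))"
    by (simp add: aux_module_def aux_coset_def)
  also have "\<dots> = (\<Union>r\<in>residue p a. \<Union>y\<in>aux_coset scale p l x. aux_coset scale p l (scale a x))"
    using eq by (intro SUP_cong refl)
  also have "\<dots> = aux_coset scale p l (scale a x)"
    using mem_aux_coset_self [of x p l] mem_residue [of a p a] by auto
  finally show ?thesis .
qed

lemma aux_module_module:
  assumes l: "l > 0"
  shows "Module.module (residue_field p) (aux_module scale p l)"
proof (rule moduleI)
  show "cring (residue_field p)" by (rule cring_residue_field)
  show "abelian_group (aux_module scale p l)"
  proof (rule abelian_groupI)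
    fix C assume "C \<in> carrier (aux_module scale p l)"
    then obtain x where x: "x \<in> tors_kernel scale p l" "C = aux_coset scale p l x"
      by (auto simp: carrier_aux_module)
    have "- x \<in> tors_kernel scale p l"
      using x(1) by (rule subspace_neg [OF subspace_tors_kernel])
    then show "\<exists>D\<in>carrier (aux_module scale p l). D \<oplus>\<^bsub>aux_module scale p l\<^esub> C = \<zero>\<^bsub>aux_module scale p l\<^esub>"
      by (intro bexI [OF _ aux_coset_in_carrier]) (auto simp: x aux_add aux_zero)
  qed (auto simp: carrier_aux_module aux_add aux_zero add_ac
        intro!: imageI subspace_add [OF subspace_tors_kernel] subspace_0 [OF subspace_tors_kernel])
next
  have sc: "scale a x \<in> tors_kernel scale p l" if "x \<in> tors_kernel scale p l" for a x
    using that by (rule subspace_scale [OF subspace_tors_kernel])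
  note [simp] = carrier_residue_field carrier_aux_module aux_smult [OF l] aux_add
    residue_add residue_mult residue_one sc subspace_add [OF subspace_tors_kernel]
  fix R R' C D
  show "R \<odot>\<^bsub>aux_module scale p l\<^esub> C \<in> carrier (aux_module scale p l)"
    if "R \<in> carrier (residue_field p)" "C \<in> carrier (aux_module scale p l)"
    using that by auto
  show "(R \<oplus>\<^bsub>residue_field p\<^esub> R') \<odot>\<^bsub>aux_module scale p l\<^esub> C =
      R \<odot>\<^bsub>aux_module scale p l\<^esub> C \<oplus>\<^bsub>aux_module scale p l\<^esub> R' \<odot>\<^bsub>aux_module scale p l\<^esub> C"
    if "R \<in> carrier (residue_field p)" "R' \<in> carrier (residue_field p)"
      "C \<in> carrier (aux_module scale p l)"
    using that by (auto simp: scale_left_distrib)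
  show "R \<odot>\<^bsub>aux_module scale p l\<^esub> (C \<oplus>\<^bsub>aux_module scale p l\<^esub> D) =
      R \<odot>\<^bsub>aux_module scale p l\<^esub> C \<oplus>\<^bsub>aux_module scale p l\<^esub> R \<odot>\<^bsub>aux_module scale p l\<^esub> D"
    if "R \<in> carrier (residue_field p)" "C \<in> carrier (aux_module scale p l)"
      "D \<in> carrier (aux_module scale p l)"
    using that by (auto simp: scale_right_distrib)
  show "(R \<otimes>\<^bsub>residue_field p\<^esub> R') \<odot>\<^bsub>aux_module scale p l\<^esub> C =
      R \<odot>\<^bsub>aux_module scale p l\<^esub> (R' \<odot>\<^bsub>aux_module scale p l\<^esub> C)"
    if "R \<in> carrier (residue_field p)" "R' \<in> carrier (residue_field p)"
      "C \<in> carrier (aux_module scale p l)"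
    using that by auto
  show "\<one>\<^bsub>residue_field p\<^esub> \<odot>\<^bsub>aux_module scale p l\<^esub> C = C"
    if "C \<in> carrier (aux_module scale p l)"
    using that by auto
qed

end

text \<open>
  The kernel \<open>K\<^sub>l\<close> is finitely generated as a submodule of \<open>T\<close>, and \<open>\<Delta>\<^sub>l\<close> is a quotient
  of it.
\<close>

lemma (in pid_module) aux_module_finitely_generated:
  assumes l: "l > 0" and B: "finite B" "span B = UNIV"
  shows "\<exists>B. finite B \<and> B \<subseteq> carrier (aux_module scale p l) \<and>
    (\<forall>N. submodule N (residue_field p) (aux_module scale p l) \<and> B \<subseteq> N \<longrightarrow>
      N = carrier (aux_module scale p l))"
proof -
  obtain C where C: "finite C" "span C = tors_kernel scale p l"
    using subspace_finitely_generated [OF B(1) subspace_tors_kernel] B(2) by blast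
  have C_sub: "C \<subseteq> tors_kernel scale p l" using C(2) span_superset by blast
  have "N = carrier (aux_module scale p l)"
    if N: "submodule N (residue_field p) (aux_module scale p l)" and sub: "aux_coset scale p l ` C \<subseteq> N"
    for N
  proof -
    interpret submodule N "residue_field p" "aux_module scale p l" by fact
    define M where "M = {x \<in> tors_kernel scale p l. aux_coset scale p l x \<in> N}"
    have "subspace M"
    proof (rule subspaceI)
      show "0 \<in> M"
        using one_closed by (simp add: M_def aux_zero subspace_0 [OF subspace_tors_kernel])
      show "x + y \<in> M" if "x \<in> M" "y \<in> M" for x y
        using that m_closed by (simp add: M_def subspace_add [OF subspace_tors_kernel] flip: aux_add)
      show "scale a x \<in> M" if "x \<in> M" for a x
        using that smult_closed [of "residue p a" "aux_coset scale p l x"]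
        by (simp add: M_def aux_smult [OF l] subspace_scale [OF subspace_tors_kernel])
    qed
    moreover have "C \<subseteq> M" using C_sub sub by (auto simp: M_def)
    ultimately have "tors_kernel scale p l \<subseteq> M" using span_minimal C(2) by blast
    then have "carrier (aux_module scale p l) \<subseteq> N" by (auto simp: carrier_aux_module M_def)
    moreover have "N \<subseteq> carrier (aux_module scale p l)" using subset by simp
    ultimately show ?thesis by blast
  qed
  moreover have "aux_coset scale p l ` C \<subseteq> carrier (aux_module scale p l)"
    using C_sub by (auto simp: carrier_aux_module)
  ultimately show ?thesis using C(1) by (intro exI [of _ "aux_coset scale p l ` C"]) blast
qed

section \<open>Auxiliary forms\<close>

context nonsingular_linking
begin

lemma power_lam_eq_0_right:
  assumes "y \<in> K k"
  shows "fract_mod_scale (p ^ k) (lam x y) = 0"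
  using assms by (simp add: mem_tors_kernel flip: lam_scale_right)

lemma power_lam_eq_0_left:
  assumes "x \<in> K k"
  shows "fract_mod_scale (p ^ k) (lam x y) = 0"
  using assms by (simp add: mem_tors_kernel lam_power_shift left.zero del: scale_scale)

lemma aux_denom_orthogonal_right:
  assumes l: "l > 0" and x: "x \<in> K l" and d: "d \<in> aux_denom scale p l"
  shows "fract_mod_scale (p ^ (l - 1)) (lam x d) = 0"
proof -
  obtain y z where yz: "d = y + scale p z" "y \<in> K (l - 1)"
    using d by (auto simp: aux_denom_def)
  have "p ^ (l - 1) * p = p ^ l" using l by (simp add: power_eq_if mult.commute)
  then have "fract_mod_scale (p ^ (l - 1)) (lam x d) =
      fract_mod_scale (p ^ (l - 1)) (lam x y) + fract_mod_scale (p ^ l) (lam x z)"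
    by (simp add: yz(1) lam_add_right lam_scale_right fract_mod.scale_right_distrib)
  then show ?thesis
    using power_lam_eq_0_right [OF yz(2)] power_lam_eq_0_left [OF x] by simp
qed

lemma aux_denom_orthogonal_left:
  assumes l: "l > 0" and y: "y \<in> K l" and d: "d \<in> aux_denom scale p l"
  shows "fract_mod_scale (p ^ (l - 1)) (lam d y) = 0"
proof -
  obtain x z where xz: "d = x + scale p z" "x \<in> K (l - 1)"
    using d by (auto simp: aux_denom_def)
  have p: "p ^ (l - 1) * (bar u * p) = bar u * p ^ l"
    using l by (simp add: power_eq_if mult_ac)
  have "fract_mod_scale (p ^ (l - 1)) (lam d y) =
      fract_mod_scale (p ^ (l - 1)) (lam x y) + fract_mod_scale (bar u) (fract_mod_scale (p ^ l) (lam z y))"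
    by (simp add: xz(1) lam_add_left lam_scale_left fract_mod.scale_right_distrib bar_p p
        del: One_nat_def)
  then show ?thesis
    using power_lam_eq_0_left [OF xz(2)] power_lam_eq_0_right [OF y] by simp
qed

lemma aux_form_value:
  assumes l: "l > 0" and x: "x \<in> K l"
  obtains a where "fract_class a p = fract_mod_scale (p ^ (l - 1)) (lam x y)"
proof -
  have "p * p ^ (l - 1) = p ^ l" using l by (simp add: power_eq_if)
  then have "fract_mod_scale p (fract_mod_scale (p ^ (l - 1)) (lam x y)) = 0"
    using power_lam_eq_0_left [OF x] by simp
  then show thesis using fract_mod_torsion [OF p_nonzero] that by metis
qed

text \<open>
  Independence of representatives: as the denominator is orthogonal to \<open>K\<^sub>l\<close>, the value
  \<open>p\<^sup>l\<^sup>-\<^sup>1\<lambda>(x, y)\<close> depends only on the cosets of \<open>x\<close> and \<open>y\<close>, and the numerators \<open>a\<close> of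
  this value over \<open>p\<close> form one residue class.
\<close>

lemma aux_form_aux_coset:
  assumes l: "l > 0" and x: "x \<in> K l" and y: "y \<in> K l"
    and a: "fract_class a p = fract_mod_scale (p ^ (l - 1)) (lam x y)"
  shows "aux_form scale lam p l (aux_coset scale p l x) (aux_coset scale p l y) = residue p a"
proof -
  have eq: "fract_mod_scale (p ^ (l - 1)) (lam x' y') = fract_class a p"
    if x': "x' \<in> aux_coset scale p l x" and y': "y' \<in> aux_coset scale p l y" for x' y'
  proof -
    have "x' \<in> K l" using aux_coset_subset [OF l x] x' by blast
    then have "fract_mod_scale (p ^ (l - 1)) (lam x' (y' - y)) = 0"
      using aux_denom_orthogonal_right [OF l] y' by (simp add: mem_aux_coset)
    moreover have "fract_mod_scale (p ^ (l - 1)) (lam (x' - x) y) = 0"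
      using aux_denom_orthogonal_left [OF l y] x' by (simp add: mem_aux_coset)
    ultimately show ?thesis
      by (simp add: a left.diff module_hom.diff [OF lam_hom] fract_mod.scale_right_diff_distrib)
  qed
  have "aux_form scale lam p l (aux_coset scale p l x) (aux_coset scale p l y) =
      {b. fract_class b p = fract_class a p}"
  proof (rule Set.set_eqI)
    fix b
    show "b \<in> aux_form scale lam p l (aux_coset scale p l x) (aux_coset scale p l y) \<longleftrightarrow>
        b \<in> {b. fract_class b p = fract_class a p}"
      unfolding aux_form_def mem_Collect_eq
      using eq mem_aux_coset_self [of x p l] mem_aux_coset_self [of y p l] by metis
  qed
  also have "\<dots> = residue p a" by (simp add: set_eq_iff mem_residue fract_class_eq_iff)
  finally show ?thesis .
qed

lemma aux_form_eq_iff: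
  assumes "l > 0" "x \<in> K l" "y \<in> K l"
  shows "b \<in> aux_form scale lam p l (aux_coset scale p l x) (aux_coset scale p l y) \<longleftrightarrow>
    fract_class b p = fract_mod_scale (p ^ (l - 1)) (lam x y)"
proof -
  obtain a where a: "fract_class a p = fract_mod_scale (p ^ (l - 1)) (lam x y)"
    using aux_form_value [OF assms(1,2)] by blast
  show ?thesis
    unfolding aux_form_aux_coset [OF assms a] a [symmetric] by (simp add: mem_residue fract_class_eq_iff)
qed

text \<open>
  The hypothesis puts \<open>p\<^sup>l\<^sup>-\<^sup>1d\<close> into \<open>K\<^sub>l\<^sup>\<bottom> = p\<^sup>lT\<close>. Writing \<open>p\<^sup>l\<^sup>-\<^sup>1d = p\<^sup>lw\<close>, the
  element \<open>d - p w\<close> lies in \<open>K\<^sub>l\<^sub>-\<^sub>1\<close>, and \<open>w\<close> in \<open>K\<^sub>l\<^sub>+\<^sub>1\<close>.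
\<close>

lemma aux_form_radical:
  assumes l: "l > 0" and d: "d \<in> K l"
    and orth: "\<And>y. y \<in> K l \<Longrightarrow> fract_mod_scale (p ^ (l - 1)) (lam d y) = 0"
  shows "d \<in> aux_denom scale p l"
proof -
  have "lam (scale (bar u ^ (l - 1)) (scale (p ^ (l - 1)) d)) y = 0" if "y \<in> K l" for y
    using orth [OF that] by (simp only: lam_power_shift)
  then obtain z where z: "scale (bar u ^ (l - 1)) (scale (p ^ (l - 1)) d) = scale (p ^ l) z"
    using orthogonal_tors_kernel by blast
  define w where "w = scale (u ^ (l - 1)) z"
  have uu: "u ^ (l - 1) * bar u ^ (l - 1) = 1"
    by (simp add: u_bar_u flip: power_mult_distrib)
  have "scale (p ^ (l - 1)) d = scale (u ^ (l - 1) * bar u ^ (l - 1)) (scale (p ^ (l - 1)) d)"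
    by (simp only: uu scale_one)
  also have "\<dots> = scale (u ^ (l - 1)) (scale (p ^ l) z)"
    by (simp only: z scale_scale [symmetric])
  also have "\<dots> = scale (p ^ l) w"
    unfolding w_def by (rule scale_left_commute)
  finally have w: "scale (p ^ (l - 1)) d = scale (p ^ l) w" .
  have "p ^ (l - 1) * p = p ^ l" using l by (simp add: power_eq_if mult.commute)
  with w have "d - scale p w \<in> K (l - 1)"
    by (simp add: mem_tors_kernel scale_right_diff_distrib)
  moreover have "w \<in> K (l + 1)"
  proof -
    have "scale (p ^ (l + 1)) w = scale p (scale (p ^ l) w)" by simp
    also have "\<dots> = scale (p * p ^ (l - 1)) d" by (simp only: w [symmetric] scale_scale)
    also have "p * p ^ (l - 1) = p ^ l" using l by (simp add: power_eq_if)
    finally show ?thesis using d by (simp add: mem_tors_kernel)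
  qed
  moreover have "d = (d - scale p w) + scale p w" by simp
  ultimately show ?thesis unfolding aux_denom_def by blast
qed

lemma symmetric_form_aux:
  assumes l: "l > 0"
  shows "symmetric_form (residue_field p) residue_bar (residue p (u ^ l * \<epsilon>))
    (aux_module scale p l) (aux_form scale lam p l)"
  unfolding symmetric_form_def
proof (intro conjI)
  let ?q = "\<lambda>x y. fract_mod_scale (p ^ (l - 1)) (lam x y)"
  let ?b = "\<lambda>x y. aux_form scale lam p l (aux_coset scale p l x) (aux_coset scale p l y)"
  have b: "?b x y = residue p a" if "x \<in> K l" "y \<in> K l" "fract_class a p = ?q x y" for x y a
    using aux_form_aux_coset [OF l] that by blast
  have add: "x + y \<in> K l" if "x \<in> K l" "y \<in> K l" for x y
    using that by (rule subspace_add [OF subspace_tors_kernel])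
  have sc: "scale a x \<in> K l" if "x \<in> K l" for a x
    using that by (rule subspace_scale [OF subspace_tors_kernel])
  show "field (residue_field p)" using pid prime by (rule field_residue_field)
  show "Module.module (residue_field p) (aux_module scale p l)" using l by (rule aux_module_module)
  show "\<exists>B. finite B \<and> B \<subseteq> carrier (aux_module scale p l) \<and>
    (\<forall>N. submodule N (residue_field p) (aux_module scale p l) \<and> B \<subseteq> N \<longrightarrow>
      N = carrier (aux_module scale p l))"
  proof -
    obtain B where "finite B" "span B = UNIV" using finitely_generated by blast
    with l show ?thesis by (rule aux_module_finitely_generated)
  qed
  have "?b x y \<in> carrier (residue_field p)" if "x \<in> K l" "y \<in> K l" for x y
    using aux_form_value [OF l that(1), of y] b [OF that] residue_in_carrier by metis
  then show "\<forall>C\<in>carrier (aux_module scale p l). \<forall>D\<in>carrier (aux_module scale p l).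
      aux_form scale lam p l C D \<in> carrier (residue_field p)"
    by (simp add: carrier_aux_module)
  have "?b (x + x') y = ?b x y \<oplus>\<^bsub>residue_field p\<^esub> ?b x' y"
    if xy: "x \<in> K l" "x' \<in> K l" "y \<in> K l" for x x' y
  proof -
    obtain a a' where a: "fract_class a p = ?q x y" and a': "fract_class a' p = ?q x' y"
      using aux_form_value [OF l] xy by metis
    have "fract_class (a + a') p = ?q (x + x') y"
      by (simp add: a a' lam_add_left fract_mod.scale_right_distrib flip: fract_class_add [OF p_nonzero])
    then show ?thesis using xy a a' by (simp add: b add residue_add)
  qed
  then show "\<forall>C\<in>carrier (aux_module scale p l). \<forall>C'\<in>carrier (aux_module scale p l).
      \<forall>D\<in>carrier (aux_module scale p l).
      aux_form scale lam p l (C \<oplus>\<^bsub>aux_module scale p l\<^esub> C') D =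
        aux_form scale lam p l C D \<oplus>\<^bsub>residue_field p\<^esub> aux_form scale lam p l C' D"
    by (simp add: carrier_aux_module aux_add)
  have "?b x (y + y') = ?b x y \<oplus>\<^bsub>residue_field p\<^esub> ?b x y'"
    if xy: "x \<in> K l" "y \<in> K l" "y' \<in> K l" for x y y'
  proof -
    obtain a a' where a: "fract_class a p = ?q x y" and a': "fract_class a' p = ?q x y'"
      using aux_form_value [OF l] xy by metis
    have "fract_class (a + a') p = ?q x (y + y')"
      by (simp add: a a' lam_add_right fract_mod.scale_right_distrib flip: fract_class_add [OF p_nonzero])
    then show ?thesis using xy a a' by (simp add: b add residue_add)
  qed
  then show "\<forall>C\<in>carrier (aux_module scale p l). \<forall>D\<in>carrier (aux_module scale p l).
      \<forall>D'\<in>carrier (aux_module scale p l).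
      aux_form scale lam p l C (D \<oplus>\<^bsub>aux_module scale p l\<^esub> D') =
        aux_form scale lam p l C D \<oplus>\<^bsub>residue_field p\<^esub> aux_form scale lam p l C D'"
    by (simp add: carrier_aux_module aux_add)
  have "?b (scale r x) y = residue_bar (residue p r) \<otimes>\<^bsub>residue_field p\<^esub> ?b x y"
    "?b x (scale r y) = residue p r \<otimes>\<^bsub>residue_field p\<^esub> ?b x y"
    if xy: "x \<in> K l" "y \<in> K l" for r x y
  proof -
    obtain a where a: "fract_class a p = ?q x y" using aux_form_value [OF l] xy by metis
    have "fract_class (bar r * a) p = ?q (scale r x) y"
      unfolding fract_class_scale [of _ a, symmetric] a lam_scale_left
      by (rule fract_mod.scale_left_commute)
    moreover have "fract_class (r * a) p = ?q x (scale r y)"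
      unfolding fract_class_scale [of _ a, symmetric] a lam_scale_right
      by (rule fract_mod.scale_left_commute)
    ultimately show "?b (scale r x) y = residue_bar (residue p r) \<otimes>\<^bsub>residue_field p\<^esub> ?b x y"
      "?b x (scale r y) = residue p r \<otimes>\<^bsub>residue_field p\<^esub> ?b x y"
      using xy a by (simp_all add: b sc residue_mult residue_bar_residue [OF p_bar])
  qed
  then show "\<forall>R\<in>carrier (residue_field p). \<forall>C\<in>carrier (aux_module scale p l).
      \<forall>D\<in>carrier (aux_module scale p l).
      aux_form scale lam p l (R \<odot>\<^bsub>aux_module scale p l\<^esub> C) D =
        residue_bar R \<otimes>\<^bsub>residue_field p\<^esub> aux_form scale lam p l C D \<and>
      aux_form scale lam p l C (R \<odot>\<^bsub>aux_module scale p l\<^esub> D) =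
        R \<otimes>\<^bsub>residue_field p\<^esub> aux_form scale lam p l C D"
    by (simp add: carrier_aux_module carrier_residue_field aux_smult [OF l])
  have "?b x y = residue p (u ^ l * \<epsilon>) \<otimes>\<^bsub>residue_field p\<^esub> residue_bar (?b y x)"
    if xy: "x \<in> K l" "y \<in> K l" for x y
  proof -
    obtain a where a: "fract_class a p = ?q y x" using aux_form_value [OF l] xy by metis
    have "u ^ (l - 1) * bar u ^ (l - 1) = 1"
      by (simp add: u_bar_u flip: power_mult_distrib)
    then have "u ^ (l - 1) * bar (p ^ (l - 1)) = p ^ (l - 1)"
      unfolding bar_p_power by (simp only: mult.assoc [symmetric] mult_1)
    then have "p ^ (l - 1) * \<epsilon> = u ^ (l - 1) * \<epsilon> * bar (p ^ (l - 1))"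
      by (metis mult.assoc mult.commute)
    then have "?q x y = fract_mod_scale (u ^ (l - 1) * \<epsilon> * bar (p ^ (l - 1))) (bar_fract_mod (lam y x))"
      using lam_sym [of x y] by (simp only: fract_mod.scale_scale)
    also have "\<dots> = fract_mod_scale (u ^ (l - 1) * \<epsilon>) (bar_fract_mod (?q y x))"
      by (simp only: bar_fract_mod_scale fract_mod.scale_scale)
    also have "\<dots> = fract_class (u ^ (l - 1) * \<epsilon> * bar a) (bar p)"
      by (simp only: a [symmetric] bar_fract_mod_fract_class fract_class_scale)
    \<comment> \<open>The conjugate of \<open>a/p\<close> is \<open>bar a / bar p = u bar a / p\<close>; this \<open>u\<close> and the
      \<open>u\<^sup>l\<^sup>-\<^sup>1\<close> from conjugating \<open>p\<^sup>l\<^sup>-\<^sup>1\<close> make up the symmetry factor \<open>u\<^sup>l\<epsilon>\<close>.\<close>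
    also have "\<dots> = fract_class (u * (u ^ (l - 1) * \<epsilon> * bar a)) (u * bar p)"
      by (rule fract_class_mult_cancel [symmetric]) (use u_bar_u in auto)
    also have "\<dots> = fract_class (u ^ l * \<epsilon> * bar a) p"
      using l by (simp add: power_eq_if mult_ac flip: u)
    finally have "?b x y = residue p (u ^ l * \<epsilon> * bar a)" using b xy by simp
    also have "\<dots> = residue p (u ^ l * \<epsilon>) \<otimes>\<^bsub>residue_field p\<^esub> residue_bar (?b y x)"
      using b [OF xy(2,1) a] by (simp add: residue_mult residue_bar_residue [OF p_bar])
    finally show ?thesis .
  qed
  then show "\<forall>C\<in>carrier (aux_module scale p l). \<forall>D\<in>carrier (aux_module scale p l).
      aux_form scale lam p l C D =
        residue p (u ^ l * \<epsilon>) \<otimes>\<^bsub>residue_field p\<^esub> residue_bar (aux_form scale lam p l D C)"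
    unfolding carrier_aux_module by fast
  show "inj_on (\<lambda>C. \<lambda>D\<in>carrier (aux_module scale p l). aux_form scale lam p l C D)
      (carrier (aux_module scale p l))"
  proof (rule inj_onI)
    fix C C' assume "C \<in> carrier (aux_module scale p l)" "C' \<in> carrier (aux_module scale p l)"
    then obtain x x' where x: "C = aux_coset scale p l x" "x \<in> K l"
      and x': "C' = aux_coset scale p l x'" "x' \<in> K l"
      by (auto simp: carrier_aux_module)
    assume *: "(\<lambda>D\<in>carrier (aux_module scale p l). aux_form scale lam p l C D) =
      (\<lambda>D\<in>carrier (aux_module scale p l). aux_form scale lam p l C' D)"
    have "x - x' \<in> aux_denom scale p l"
    proof (rule aux_form_radical [OF l])
      show "x - x' \<in> K l" using x x' by (intro subspace_diff [OF subspace_tors_kernel])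
      fix y assume y: "y \<in> K l"
      then have "?b x y = ?b x' y"
        using fun_cong [OF *, of "aux_coset scale p l y"]
        by (simp add: aux_coset_in_carrier x(1) x'(1))
      moreover obtain a where a: "fract_class a p = ?q x y" using aux_form_value [OF l x(2)] by blast
      ultimately have "fract_class a p = ?q x' y"
        using aux_form_eq_iff [OF l] x(2) x'(2) y by blast
      with a show "?q (x - x') y = 0"
        by (simp add: left.diff fract_mod.scale_right_diff_distrib)
    qed
    then show "C = C'" by (simp add: x(1) x'(1) aux_coset_eq_iff)
  qed
qed

end

section \<open>Hermitian square roots\<close>

text \<open>
  Let \<open>t = c + bar c\<close> for a representative \<open>c\<close> of the half-unit. The truncated geometric series
  \<open>e = 1 + (1 - t) + \<dots> + (1 - t)\<^sup>n\<^sup>-\<^sup>1\<close> inverts \<open>t\<close> modulo \<open>p\<^sup>n\<close>, and being a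
  polynomial in \<open>t\<close> it is invariant under the involution, so that \<open>c e\<close> has trace \<open>t e\<close>.
\<close>

lemma half_unit_lift:
  fixes p :: "'a::{idom, involution_ring}"
  assumes p_bar: "bar ` principal_ideal p = principal_ideal p"
    and half: "half_unit (residue_field p) residue_bar s"
  shows "\<exists>c. p ^ n dvd c + bar c - 1"
proof -
  have "s \<in> carrier (residue_field p)"
    using half by (simp add: half_unit_def Units_def)
  then obtain c where c: "s = residue p c" by (auto simp: carrier_residue_field)
  define t where "t = c + bar c"
  have "residue p t = residue p 1"
    using half
    by (simp add: half_unit_def c t_def residue_bar_residue [OF p_bar] residue_add residue_one)
  then have "p dvd 1 - t" by (metis residue_eq_iff)
  define e where "e = (\<Sum>i<n. (1 - t) ^ i)"
  have bar_t: "bar t = t" by (simp add: t_def bar_add add.commute)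
  have "bar e = e" by (simp add: e_def bar_sum bar_power bar_diff bar_one bar_t)
  then have "c * e + bar (c * e) - 1 = - (1 - t * e)"
    by (simp add: t_def bar_mult algebra_simps)
  also have "1 - t * e = (1 - t) ^ n"
    using one_diff_power_eq [of "1 - t" n] by (simp add: e_def algebra_simps)
  finally have "p ^ n dvd c * e + bar (c * e) - 1"
    using dvd_power_same [OF \<open>p dvd 1 - t\<close>, of n] by simp
  then show ?thesis by blast
qed

text \<open>
  The coefficients of a power series \<open>f\<close> with constant term \<open>1\<close> and \<open>bar f \<cdot> f = 1 + X\<close>, modulo
  any \<open>d\<close> that divides \<open>c + bar c - 1\<close>. In degree \<open>m > 0\<close> the equation reads
  \<open>f\<^sub>m + bar f\<^sub>m = r\<close>, where \<open>r\<close> depends on lower coefficients only and is invariant under the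
  involution; \<open>f\<^sub>m = c r\<close> is a solution.
\<close>

fun sqrt_coeff :: "'a::involution_ring \<Rightarrow> nat \<Rightarrow> 'a" where
  "sqrt_coeff c 0 = 1"
| "sqrt_coeff c (Suc m) = c * ((if m = 0 then 1 else 0) -
    (\<Sum>i\<in>{1..m}. bar (sqrt_coeff c i) * sqrt_coeff c (Suc m - i)))"

lemma sqrt_coeff_convolution:
  assumes "d dvd c + bar c - 1"
  shows "d dvd (\<Sum>i\<le>m. bar (sqrt_coeff c i) * sqrt_coeff c (m - i)) - (if m \<le> 1 then 1 else 0)"
proof (cases m)
  case 0
  then show ?thesis by (simp add: bar_one)
next
  case (Suc k)
  let ?f = "sqrt_coeff c"
  define s where "s = (\<Sum>i\<in>{1..k}. bar (?f i) * ?f (Suc k - i))"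
  define r where "r = (if k = 0 then 1 else 0) - s"
  have f: "?f (Suc k) = c * r" by (simp add: r_def s_def)
  have "bar s = (\<Sum>i\<in>{1..k}. bar (?f (Suc k - i)) * ?f i)"
    by (simp add: s_def bar_sum bar_mult mult.commute)
  also have "\<dots> = s"
    unfolding s_def
    by (rule sum.reindex_bij_witness [of _ "\<lambda>i. Suc k - i" "\<lambda>i. Suc k - i"]) auto
  finally have bar_r: "bar r = r" by (simp add: r_def bar_diff bar_one)
  have "(\<Sum>i\<le>Suc k. bar (?f i) * ?f (Suc k - i)) = ?f (Suc k) + s + bar (?f (Suc k))"
  proof -
    have "{..Suc k} = insert 0 (insert (Suc k) {1..k})" by auto
    then show ?thesis by (simp add: s_def bar_one del: sqrt_coeff.simps(2))
  qed
  also have "\<dots> - (if Suc k \<le> 1 then 1 else 0) = (c + bar c - 1) * r"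
    unfolding f by (simp add: bar_mult bar_r) (simp add: r_def algebra_simps)
  finally show ?thesis using assms Suc by simp
qed

section \<open>Isometries from agreement of the auxiliary forms\<close>

lemma (in Modules.module) module_hom_funpow:
  assumes "module_hom scale scale N"
  shows "module_hom scale scale (N ^^ k)"
proof (induction k)
  case 0
  then show ?case using module_hom_id by (simp add: id_def)
next
  case (Suc k)
  then show ?case using module_hom_compose [OF Suc assms] by (simp add: comp_def)
qed

text \<open>
  Put \<open>G(l, j) = p\<^sup>jK\<^sub>l\<^sub>+\<^sub>j\<close>. Acting as zero on all \<open>\<Delta>\<^sub>l\<close>, the map \<open>N\<close> sends \<open>G(l, j)\<close>
  into \<open>G(l - 1, j) + G(l, j + 1)\<close>. Each application thus lowers the weight \<open>l + (n - j)\<close>, and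
  \<open>G(0, j)\<close> and \<open>G(l, n)\<close> are zero when \<open>p\<^sup>n\<close> kills \<open>T = G(n, 0)\<close>.
\<close>

lemma (in nonsingular_linking) nilpotent:
  assumes N: "module_hom scale scale N"
    and vanish: "\<And>l x. l > 0 \<Longrightarrow> x \<in> K l \<Longrightarrow> N x \<in> aux_denom scale p l"
  shows "\<exists>k. \<forall>x. (N ^^ k) x = 0"
proof -
  obtain n where n: "\<And>x. scale (p ^ n) x = 0" using exponent by blast
  note pow = module_hom_funpow [OF N]
  have "(N ^^ m) (scale (p ^ j) x) = 0" if "x \<in> K (l + j)" "l + (n - j) \<le> m" for m l j x
    using that
  proof (induction m arbitrary: l j x)
    case 0
    then show ?case by (simp add: mem_tors_kernel)
  next
    case (Suc m)
    consider "l = 0" | "j \<ge> n" | "l > 0" "j < n" by linarith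
    then show ?case
    proof cases
      case 1
      then show ?thesis
        using Suc.prems(1) module_hom.zero [OF pow, of "Suc m"] by (simp add: mem_tors_kernel)
    next
      case 2
      then have "scale (p ^ j) x = scale (p ^ (j - n)) (scale (p ^ n) x)"
        by (simp flip: power_add)
      then show ?thesis using module_hom.zero [OF pow, of "Suc m"] by (simp only: n scale_zero_right)
    next
      case 3
      then have "N x \<in> aux_denom scale p (l + j)" using vanish Suc.prems(1) by simp
      then obtain y z where yz: "N x = y + scale p z" "y \<in> K (l + j - 1)" "z \<in> K (l + j + 1)"
        by (auto simp: aux_denom_def)
      have "(N ^^ m) (scale (p ^ j) y) = 0"
        using yz(2) 3 Suc.prems(2) by (intro Suc.IH [of y "l - 1" j]) auto
      moreover have "(N ^^ m) (scale (p ^ (j + 1)) z) = 0"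
        using yz(3) 3 Suc.prems(2) by (intro Suc.IH [of z l "j + 1"]) auto
      moreover have "N (scale (p ^ j) x) = scale (p ^ j) y + scale (p ^ (j + 1)) z"
        by (simp add: module_hom.scale [OF N] yz(1) scale_right_distrib mult.commute)
      ultimately show ?thesis
        by (simp only: funpow_Suc_right comp_apply module_hom.add [OF pow] add_0)
    qed
  qed
  from this [of _ n 0 "n + n"] have "(N ^^ (n + n)) x = 0" for x
    by (simp add: mem_tors_kernel n)
  then show ?thesis by blast
qed

text \<open>
  The map \<open>g\<close> is the square root \<open>f(N)\<close> of \<open>1 + N\<close>, where \<open>N\<close> measures the difference of the
  two forms. It is injective because \<open>\<mu>\<close> is nondegenerate; it is surjective because it has
  constant term \<open>1\<close> in the nilpotent \<open>N\<close>, which shows by descending induction on \<open>j\<close> that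
  \<open>N\<^sup>jT\<close> lies in its image.
\<close>

lemma (in nonsingular_linking) isometry_of_aux_forms_agree:
  assumes half: "\<And>n. \<exists>c. p ^ n dvd c + bar c - 1"
    and mu: "linking_form S \<epsilon> scale mu"
    and agree: "\<And>l x y. l > 0 \<Longrightarrow> x \<in> K l \<Longrightarrow> y \<in> K l \<Longrightarrow>
      fract_mod_scale (p ^ (l - 1)) (mu x y) = fract_mod_scale (p ^ (l - 1)) (lam x y)"
  shows "\<exists>g. module_iso scale scale g \<and> (\<forall>x y. lam (g x) (g y) = mu x y)"
proof -
  interpret mu: linking scale S \<epsilon> mu by unfold_locales (rule mu)
  have "\<exists>z. lam z = (\<lambda>y. mu x y - lam x y)" for x
    by (rule represent)
       (simp add: module_hom_iff module_axioms fract_mod.module_axioms lam_add_right lam_scale_right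
          mu.lam_add_right mu.lam_scale_right fract_mod.scale_right_diff_distrib)
  then obtain N where "\<And>x. lam (N x) = (\<lambda>y. mu x y - lam x y)" by metis
  then have N: "lam (N x) y = mu x y - lam x y" for x y by simp
  have N_hom: "module_hom scale scale N"
    unfolding module_hom_iff
  proof (intro conjI allI)
    show "N (x + x') = N x + N x'" for x x'
      by (rule lam_inj) (simp add: lam_add_left N mu.lam_add_left)
    show "N (scale a x) = scale a (N x)" for a x
      by (rule lam_inj)
         (simp add: lam_scale_left N mu.lam_scale_left fract_mod.scale_right_diff_distrib)
  qed (rule module_axioms)+
  have adj: "lam (N x) y = lam x (N y)" for x y
  proof -
    have "lam (N x) y = fract_mod_scale \<epsilon> (bar_fract_mod (mu y x)) -
        fract_mod_scale \<epsilon> (bar_fract_mod (lam y x))"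
      unfolding N using mu.lam_sym [of x y] lam_sym [of x y] by simp
    also have "\<dots> = fract_mod_scale \<epsilon> (bar_fract_mod (lam (N y) x))"
      by (simp add: N bar_fract_mod_diff fract_mod.scale_right_diff_distrib)
    finally show ?thesis using lam_sym [of x "N y"] by simp
  qed
  have "N x \<in> aux_denom scale p l" if l: "l > 0" and x: "x \<in> K l" for l x
  proof (rule aux_form_radical [OF l])
    show "N x \<in> K l"
      using x by (simp add: mem_tors_kernel module_hom.zero [OF N_hom] flip: module_hom.scale [OF N_hom])
    show "fract_mod_scale (p ^ (l - 1)) (lam (N x) y) = 0" if "y \<in> K l" for y
      using agree [OF l x that] by (simp add: N fract_mod.scale_right_diff_distrib)
  qed
  then obtain k where k: "\<And>x. (N ^^ k) x = 0" using nilpotent [OF N_hom] by blast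
  note pow = module_hom_funpow [OF N_hom]
  \<comment> \<open>At least two terms are needed so that both terms of \<open>1 + X\<close> are below the cut-off.\<close>
  define m where "m = Suc (Suc k)"
  have nil: "(N ^^ i) x = 0" if "i \<ge> m" for i x
  proof -
    have "i = (i - k) + k" using that by (simp add: m_def)
    then have "(N ^^ i) x = (N ^^ (i - k)) ((N ^^ k) x)" by (metis comp_apply funpow_add)
    then show ?thesis by (simp add: k module_hom.zero [OF pow])
  qed
  obtain n where n: "\<And>x. scale (p ^ n) x = 0" using exponent by blast
  obtain c where c: "p ^ n dvd c + bar c - 1" using half by blast
  define f where "f = sqrt_coeff c"
  define g where "g x = (\<Sum>i<m. scale (f i) ((N ^^ i) x))" for x
  have isometric: "lam (g x) (g y) = mu x y" for x y
  proof -
    define L where "L i = lam ((N ^^ i) x) y" for i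
    have L_0: "L i = 0" if "i \<ge> m" for i using that by (simp add: L_def nil left.zero)
    have adj_pow: "lam ((N ^^ i) x') ((N ^^ j) y) = lam ((N ^^ (i + j)) x') y" for i j x'
    proof (induction j arbitrary: x')
      case (Suc j)
      have "lam ((N ^^ i) x') ((N ^^ Suc j) y) = lam (N ((N ^^ i) x')) ((N ^^ j) y)"
        by (simp add: adj)
      also have "\<dots> = lam ((N ^^ i) (N x')) ((N ^^ j) y)" by (simp add: funpow_swap1)
      also have "\<dots> = lam ((N ^^ (i + Suc j)) x') y"
        using Suc [of "N x'"] by (simp add: funpow_swap1)
      finally show ?case .
    qed simp
    define P where "P i = (\<Sum>j\<le>i. bar (f j) * f (i - j))" for i
    have P: "fract_mod_scale (P i) (L i) = (if i \<le> 1 then L i else 0)" for i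
    proof -
      obtain b where b: "P i - (if i \<le> 1 then 1 else 0) = b * p ^ n"
        using sqrt_coeff_convolution [OF c, of i]
        unfolding P_def f_def by (metis dvd_def mult.commute)
      have "P i = (if i \<le> 1 then 1 else 0) + b * p ^ n" using b by (simp add: algebra_simps)
      then have "fract_mod_scale (P i) (L i) = fract_mod_scale (if i \<le> 1 then 1 else 0) (L i) +
          fract_mod_scale b (fract_mod_scale (p ^ n) (L i))"
        by (simp only: fract_mod.scale_left_distrib fract_mod.scale_scale)
      also have "fract_mod_scale (p ^ n) (L i) = 0"
        unfolding L_def by (rule power_lam_eq_0_right) (simp add: mem_tors_kernel n)
      finally show ?thesis by simp
    qed
    have "lam (g x) (g y) =
        (\<Sum>i<m. \<Sum>j<m. lam (scale (f i) ((N ^^ i) x)) (scale (f j) ((N ^^ j) y)))"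
      unfolding g_def by (subst left.sum) (simp only: lam_sum_right)
    also have "\<dots> = (\<Sum>i<m. \<Sum>j<m. fract_mod_scale (bar (f i) * f j) (L (i + j)))"
      by (simp only: lam_scale_left lam_scale_right adj_pow L_def fract_mod.scale_scale mult.commute)
    also have "\<dots> = (\<Sum>(i, j)\<in>{..<m} \<times> {..<m}. fract_mod_scale (bar (f i) * f j) (L (i + j)))"
      by (rule sum.cartesian_product)
    \<comment> \<open>Nilpotency removes the terms of total degree at least \<open>m\<close>; the rest is sorted by degree.\<close>
    also have "\<dots> = (\<Sum>(i, j)\<in>{(i, j). i + j < m}. fract_mod_scale (bar (f i) * f j) (L (i + j)))"
      by (rule sum.mono_neutral_right) (auto, metis L_0 fract_mod.scale_zero_right not_less)
    also have "\<dots> = (\<Sum>i<m. \<Sum>j\<le>i. fract_mod_scale (bar (f j) * f (i - j)) (L (j + (i - j))))"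
      by (rule sum.triangle_reindex)
    also have "\<dots> = (\<Sum>i<m. fract_mod_scale (P i) (L i))"
      by (simp add: P_def fract_mod.scale_sum_left)
    also have "\<dots> = (\<Sum>i<m. if i \<le> 1 then L i else 0)" by (simp add: P)
    also have "\<dots> = L 0 + L 1"
      unfolding m_def by (simp only: sum.lessThan_Suc_shift) simp
    also have "\<dots> = mu x y" by (simp add: L_def N)
    finally show ?thesis .
  qed
  have g_hom: "module_hom scale scale g"
    unfolding module_hom_iff g_def
    by (simp add: module_axioms module_hom.add [OF pow] module_hom.scale [OF pow] sum.distrib
        scale_right_distrib scale_sum_right mult.commute)
  have "inj g"
  proof (rule injI)
    fix x x' assume "g x = g x'"
    then have "mu x y = mu x' y" for y by (simp flip: isometric)
    then show "x = x'" by (rule mu.lam_inj)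
  qed
  moreover have "x \<in> range g" for x
  proof -
    have range: "subspace (range g)"
      by (rule module_hom.subspace_image [OF g_hom subspace_UNIV])
    have "\<forall>x. (N ^^ j) x \<in> range g" if "j \<le> m" for j
      using that
    proof (induction rule: inc_induct)
      case base
      show ?case using nil subspace_0 [OF range] by simp
    next
      case (step j)
      show ?case
      proof
        fix x
        have "(N ^^ i) ((N ^^ j) x) \<in> range g" if "i \<noteq> 0" for i
        proof -
          have "i + j = Suc j + (i - 1)" using that by simp
          then have "(N ^^ i) ((N ^^ j) x) = (N ^^ Suc j) ((N ^^ (i - 1)) x)"
            by (metis comp_apply funpow_add)
          then show ?thesis using step.IH by simp
        qed
        then have "(\<Sum>i\<in>{..<m} - {0}. scale (f i) ((N ^^ i) ((N ^^ j) x))) \<in> range g"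
          by (intro subspace_sum [OF range] subspace_scale [OF range]) auto
        moreover have "g ((N ^^ j) x) =
            (N ^^ j) x + (\<Sum>i\<in>{..<m} - {0}. scale (f i) ((N ^^ i) ((N ^^ j) x)))"
          unfolding g_def by (subst sum.remove [of _ 0]) (simp_all add: m_def f_def)
        ultimately have "g ((N ^^ j) x) - (N ^^ j) x \<in> range g" by simp
        from subspace_diff [OF range rangeI [of g "(N ^^ j) x"] this]
        show "(N ^^ j) x \<in> range g" by simp
      qed
    qed
    from this [of 0] show ?thesis by simp
  qed
  ultimately have "module_iso scale scale g"
    using g_hom by (auto simp: module_iso_def bij_def)
  with isometric show ?thesis by blast
qed

section \<open>Transport along isomorphisms\<close>

lemma module_iso_inv:
  assumes h: "module_iso scale scale' h"
  shows "module_iso scale' scale (inv_into UNIV h)"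
proof -
  interpret h: Modules.module_hom scale scale' h using h by (simp add: module_iso_def)
  interpret module_pair scale scale' ..
  show ?thesis
    using h by (simp add: module_iso_def bij_module_hom_imp_inv_module_hom bij_imp_bij_inv)
qed

lemma linking_form_pullback:
  assumes scale: "Modules.module scale"
    and form: "linking_form S \<epsilon> scale' lam'" and h: "module_iso scale scale' h"
  shows "linking_form S \<epsilon> scale (\<lambda>x y. lam' (h x) (h y))"
proof -
  have hom: "module_hom scale scale' h" and bij: "bij h"
    using h by (auto simp: module_iso_def)
  interpret h: Modules.module_hom scale scale' h by (rule hom)
  have inv: "module_hom scale' scale (inv_into UNIV h)"
    using module_iso_inv [OF h] by (simp add: module_iso_def)
  obtain B where B: "finite B" "h.m2.span B = UNIV"
    using form unfolding linking_form_def by blast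
  have "h.m1.span (inv_into UNIV h ` B) = inv_into UNIV h ` h.m2.span B"
    by (rule module_hom.span_image [OF inv])
  then have "h.m1.span (inv_into UNIV h ` B) = UNIV"
    using B(2) bij by (metis bij_imp_bij_inv bij_is_surj)
  moreover have "finite (inv_into UNIV h ` B)" using B(1) by simp
  moreover have "\<exists>s\<in>S. scale s x = 0" for x
  proof -
    obtain s where "s \<in> S" "scale' s (h x) = 0"
      using form unfolding linking_form_def by blast
    moreover from this have "h (scale s x) = h 0" by (simp add: h.scale)
    then have "scale s x = 0" by (rule injD [OF bij_is_inj [OF bij]])
    ultimately show ?thesis by blast
  qed
  moreover have "(\<lambda>y. lam' (h x) (h y)) \<in> torsion_dual S scale" for x
  proof -
    have lam': "module_hom scale' fract_mod_scale (lam' (h x))" "range (lam' (h x)) \<subseteq> loc_quot S"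
      using form unfolding linking_form_def torsion_dual_def by blast+
    have "module_hom scale fract_mod_scale (\<lambda>y. lam' (h x) (h y))"
      using module_hom_compose [OF hom lam'(1)] by (simp add: comp_def)
    with lam'(2) show ?thesis by (auto simp: torsion_dual_def)
  qed
  moreover have "lam' (h (x + x')) (h y) = lam' (h x) (h y) + lam' (h x') (h y)" for x x' y
    using form unfolding linking_form_def h.add by blast
  moreover have "lam' (h (scale a x)) (h y) = fract_mod_scale (bar a) (lam' (h x) (h y))" for a x y
    using form unfolding linking_form_def h.scale by blast
  moreover have "inj (\<lambda>x y. lam' (h x) (h y))"
  proof (rule injI)
    fix x x' assume eq: "(\<lambda>y. lam' (h x) (h y)) = (\<lambda>y. lam' (h x') (h y))"
    have "lam' (h x) z = lam' (h x') z" for z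
      using fun_cong [OF eq, of "inv_into UNIV h z"] bij by (simp add: bij_is_surj surj_f_inv_f)
    moreover have "inj lam'" using form unfolding linking_form_def by blast
    ultimately have "h x = h x'" by (intro injD [of lam']) auto
    then show "x = x'" by (rule injD [OF bij_is_inj [OF bij]])
  qed
  moreover have "lam' (h x) (h y) = fract_mod_scale \<epsilon> (bar_fract_mod (lam' (h y) (h x)))" for x y
    using form unfolding linking_form_def by blast
  ultimately show ?thesis
    unfolding linking_form_def using scale by blast
qed

context
  fixes scale :: "'a::comm_ring_1 \<Rightarrow> 't::ab_group_add \<Rightarrow> 't"
    and scale' :: "'a \<Rightarrow> 't'::ab_group_add \<Rightarrow> 't'" and h
  assumes iso: "module_iso scale scale' h"
begin

interpretation h: Modules.module_hom scale scale' h
  using iso by (simp add: module_iso_def)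

lemma module_iso_tors_kernel: "h ` tors_kernel scale p m = tors_kernel scale' p m"
proof -
  have "h x \<in> tors_kernel scale' p m \<longleftrightarrow> x \<in> tors_kernel scale p m" for x
  proof -
    have "scale' (p ^ m) (h x) = 0 \<longleftrightarrow> h (scale (p ^ m) x) = h 0" by (simp add: h.scale)
    also have "\<dots> \<longleftrightarrow> scale (p ^ m) x = 0"
      using iso by (simp only: module_iso_def bij_def inj_eq)
    finally show ?thesis by (simp add: tors_kernel_def)
  qed
  moreover have "surj h" using iso by (simp add: module_iso_def bij_is_surj)
  ultimately show ?thesis by (metis image_Collect_subsetI image_eqI subsetI subset_antisym surjD image_subsetI)
qed

lemma module_iso_aux_denom: "h ` aux_denom scale p l = aux_denom scale' p l"
proof -
  have "aux_denom scale' p l =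
    {x + scale' p y | x y. x \<in> h ` tors_kernel scale p (l - 1) \<and> y \<in> h ` tors_kernel scale p (l + 1)}"
    unfolding module_iso_tors_kernel aux_denom_def ..
  also have "\<dots> = h ` aux_denom scale p l"
    unfolding aux_denom_def by (fastforce simp: h.add h.scale image_iff)
  finally show ?thesis by (rule sym)
qed

lemma module_iso_aux_coset: "h ` aux_coset scale p l x = aux_coset scale' p l (h x)"
  unfolding aux_coset_def module_iso_aux_denom [symmetric] image_image h.add ..

end

lemma linking_form_iso_aux_form:
  assumes "linking_form_iso scale lam scale' lam' h"
  shows "aux_form scale' lam' p l (h ` C) (h ` D) = aux_form scale lam p l C D"
  using assms by (auto simp: aux_form_def linking_form_iso_def)

lemma symmetric_form_iso_aux:
  assumes T: "nonsingular_linking scale p \<epsilon> lam u" and T': "nonsingular_linking scale' p \<epsilon> lam' u"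
    and h: "linking_form_iso scale lam scale' lam' h" and l: "l > 0"
  shows "symmetric_form_iso (residue_field p) residue_bar (residue p (u ^ l * \<epsilon>))
        (aux_module scale p l) (aux_form scale lam p l)
        (aux_module scale' p l) (aux_form scale' lam' p l)
        (\<lambda>C. h ` C)"
proof -
  interpret T: nonsingular_linking scale p \<epsilon> lam u by (rule T)
  interpret T': nonsingular_linking scale' p \<epsilon> lam' u by (rule T')
  have iso: "module_iso scale scale' h" using h by (simp add: linking_form_iso_def)
  then interpret h: Modules.module_hom scale scale' h by (simp add: module_iso_def)
  have inj: "inj h" using iso by (simp add: module_iso_def bij_is_inj)
  note coset = module_iso_aux_coset [OF iso]
  have K: "h x \<in> tors_kernel scale' p l" if "x \<in> tors_kernel scale p l" for x
    using that module_iso_tors_kernel [OF iso] by blast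
  show ?thesis
    unfolding symmetric_form_iso_def
  proof (intro conjI)
    have "inj_on ((`) h) (carrier (aux_module scale p l))"
      by (rule inj_onI) (simp add: inj_image_eq_iff [OF inj])
    moreover have "(`) h ` carrier (aux_module scale p l) = carrier (aux_module scale' p l)"
      unfolding T.carrier_aux_module T'.carrier_aux_module image_image coset
      by (simp only: module_iso_tors_kernel [OF iso, symmetric] image_image)
    ultimately show "bij_betw (\<lambda>C. h ` C) (carrier (aux_module scale p l)) (carrier (aux_module scale' p l))"
      by (simp add: bij_betw_def)
    show "\<forall>C\<in>carrier (aux_module scale p l). \<forall>D\<in>carrier (aux_module scale p l).
        h ` (C \<oplus>\<^bsub>aux_module scale p l\<^esub> D) = h ` C \<oplus>\<^bsub>aux_module scale' p l\<^esub> h ` D"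
      by (simp add: T.carrier_aux_module T.aux_add T'.aux_add coset h.add)
    show "\<forall>R\<in>carrier (residue_field p). \<forall>C\<in>carrier (aux_module scale p l).
        h ` (R \<odot>\<^bsub>aux_module scale p l\<^esub> C) = R \<odot>\<^bsub>aux_module scale' p l\<^esub> h ` C"
      by (simp add: T.carrier_aux_module carrier_residue_field T.aux_smult [OF l]
          T'.aux_smult [OF l] coset K h.scale)
    show "\<forall>C\<in>carrier (aux_module scale p l). \<forall>D\<in>carrier (aux_module scale p l).
        aux_form scale' lam' p l (h ` C) (h ` D) = aux_form scale lam p l C D"
      using linking_form_iso_aux_form [OF h] by blast
  qed (rule T.symmetric_form_aux T'.symmetric_form_aux, rule l)+
qed

text \<open>
  The pullback \<open>\<mu>\<close> of \<open>\<lambda>'\<close> along \<open>h\<close> has the same auxiliary forms as \<open>\<lambda>\<close>. If \<open>g\<close> is an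
  isometry from \<open>\<mu>\<close> to \<open>\<lambda>\<close>, then \<open>h \<circ> g\<^sup>-\<^sup>1\<close> is one from \<open>\<lambda>\<close> to \<open>\<lambda>'\<close>; in
  general this is not the given \<open>h\<close>.
\<close>

lemma linking_form_iso_of_aux_forms:
  assumes T: "nonsingular_linking scale p \<epsilon> lam u" and T': "nonsingular_linking scale' p \<epsilon> lam' u"
    and half: "half_unit (residue_field p) residue_bar s"
    and h: "module_iso scale scale' h"
    and aux: "\<And>l. l > 0 \<Longrightarrow> symmetric_form_iso (residue_field p) residue_bar (residue p (u ^ l * \<epsilon>))
        (aux_module scale p l) (aux_form scale lam p l)
        (aux_module scale' p l) (aux_form scale' lam' p l)
        (\<lambda>C. h ` C)"
  shows "\<exists>k. linking_form_iso scale lam scale' lam' k"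
proof -
  interpret T: nonsingular_linking scale p \<epsilon> lam u by (rule T)
  interpret T': nonsingular_linking scale' p \<epsilon> lam' u by (rule T')
  define mu where "mu x y = lam' (h x) (h y)" for x y
  have "\<exists>g. module_iso scale scale g \<and> (\<forall>x y. lam (g x) (g y) = mu x y)"
  proof (rule T.isometry_of_aux_forms_agree)
    show "\<exists>c. p ^ n dvd c + bar c - 1" for n
      using T.p_bar half by (rule half_unit_lift)
    show "linking_form (prime_powers p) \<epsilon> scale mu"
      unfolding mu_def using T.module_axioms T'.form h by (rule linking_form_pullback)
    fix l :: nat and x y
    assume l: "l > 0" and x: "x \<in> T.K l" and y: "y \<in> T.K l"
    obtain a where a: "fract_class a p = fract_mod_scale (p ^ (l - 1)) (lam x y)"
      using T.aux_form_value [OF l x] by blast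
    have hK: "h x \<in> T'.K l" "h y \<in> T'.K l"
      using x y module_iso_tors_kernel [OF h] by blast+
    have "aux_form scale' lam' p l (aux_coset scale' p l (h x)) (aux_coset scale' p l (h y)) =
        aux_form scale lam p l (aux_coset scale p l x) (aux_coset scale p l y)"
      using aux [OF l] x y
      by (simp add: symmetric_form_iso_def T.aux_coset_in_carrier flip: module_iso_aux_coset [OF h])
    then have "fract_class a p = fract_mod_scale (p ^ (l - 1)) (lam' (h x) (h y))"
      using a T.aux_form_eq_iff [OF l x y] T'.aux_form_eq_iff [OF l hK] by blast
    with a show "fract_mod_scale (p ^ (l - 1)) (mu x y) = fract_mod_scale (p ^ (l - 1)) (lam x y)"
      by (simp add: mu_def)
  qed
  then obtain g where g: "module_iso scale scale g" "\<And>x y. lam (g x) (g y) = lam' (h x) (h y)"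
    by (auto simp: mu_def)
  have bij: "bij g" "bij h" and hom: "module_hom scale scale g" "module_hom scale scale' h"
    using g(1) h by (auto simp: module_iso_def)
  have "module_hom scale scale (inv_into UNIV g)"
    using module_iso_inv [OF g(1)] by (simp add: module_iso_def)
  then have "module_hom scale scale' (h \<circ> inv_into UNIV g)" using hom(2) by (rule module_hom_compose)
  moreover have "bij (h \<circ> inv_into UNIV g)" using bij by (simp add: bij_comp bij_imp_bij_inv)
  moreover have "lam' ((h \<circ> inv_into UNIV g) x) ((h \<circ> inv_into UNIV g) y) = lam x y" for x y
    using bij(1) by (simp add: bij_is_surj surj_f_inv_f flip: g(2))
  ultimately have "linking_form_iso scale lam scale' lam' (h \<circ> inv_into UNIV g)"
    by (simp add: linking_form_iso_def module_iso_def)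
  then show ?thesis by blast
qed

theorem theorem2p2p19:
  fixes p u \<epsilon> :: "'a::{idom, involution_ring}"
    and scale :: "'a \<Rightarrow> 't::ab_group_add \<Rightarrow> 't" and lam :: "'t \<Rightarrow> 't \<Rightarrow> 'a fract_mod"
    and scale' :: "'a \<Rightarrow> 't'::ab_group_add \<Rightarrow> 't'" and lam' :: "'t' \<Rightarrow> 't' \<Rightarrow> 'a fract_mod"
  assumes pid: "principal_domain (ring_of_type_algebra :: 'a ring)"
    and p_prime: "prime_elem p"
    and p_bar: "bar ` principal_ideal p = principal_ideal p"
    and u: "p = u * bar p"
    and eps: "\<epsilon> * bar \<epsilon> = 1"
    and half: "\<exists>s. half_unit (residue_field p) residue_bar s"
    and T: "nonsingular_linking_form (prime_powers p) \<epsilon> scale lam"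
    and T': "nonsingular_linking_form (prime_powers p) \<epsilon> scale' lam'"
  shows "(\<exists>h. linking_form_iso scale lam scale' lam' h) \<longleftrightarrow>
    (\<exists>h. module_iso scale scale' h \<and>
      (\<forall>l>0. symmetric_form_iso (residue_field p) residue_bar (residue p (u ^ l * \<epsilon>))
        (aux_module scale p l) (aux_form scale lam p l)
        (aux_module scale' p l) (aux_form scale' lam' p l)
        (\<lambda>C. h ` C)))"
proof -
  have N: "nonsingular_linking scale p \<epsilon> lam u"
    if "nonsingular_linking_form (prime_powers p) \<epsilon> scale lam"
    for scale :: "'a \<Rightarrow> 's::ab_group_add \<Rightarrow> 's" and lam
  proof -
    from that have form: "linking_form (prime_powers p) \<epsilon> scale lam"
      and range: "range lam = torsion_dual (prime_powers p) scale"
      by (auto simp: nonsingular_linking_form_def bij_betw_def)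
    then have "Modules.module scale" unfolding linking_form_def by blast
    then show ?thesis
      using form range pid p_prime p_bar u
      by (intro nonsingular_linking.intro linking.intro pid_module.intro pid_module_axioms.intro
          linking_axioms.intro nonsingular_linking_axioms.intro)
  qed
  show ?thesis
  proof
    assume "\<exists>h. linking_form_iso scale lam scale' lam' h"
    then obtain h where h: "linking_form_iso scale lam scale' lam' h" by blast
    then have "module_iso scale scale' h" by (simp add: linking_form_iso_def)
    with symmetric_form_iso_aux [OF N [OF T] N [OF T'] h]
    show "\<exists>h. module_iso scale scale' h \<and>
      (\<forall>l>0. symmetric_form_iso (residue_field p) residue_bar (residue p (u ^ l * \<epsilon>))
        (aux_module scale p l) (aux_form scale lam p l)
        (aux_module scale' p l) (aux_form scale' lam' p l)
        (\<lambda>C. h ` C))"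
      by blast
  next
    assume "\<exists>h. module_iso scale scale' h \<and>
      (\<forall>l>0. symmetric_form_iso (residue_field p) residue_bar (residue p (u ^ l * \<epsilon>))
        (aux_module scale p l) (aux_form scale lam p l)
        (aux_module scale' p l) (aux_form scale' lam' p l)
        (\<lambda>C. h ` C))"
    then show "\<exists>h. linking_form_iso scale lam scale' lam' h"
      using half linking_form_iso_of_aux_forms [OF N [OF T] N [OF T']] by blast
  qed
qed

end
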